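(* Let $(Z,d,\mu)$, $Q$, $X$, $\mathrm{Tr}$, $P$ be as in the context, and let $0<s<\infty$, $Q/(Q+s)<p\le\infty$, $0<q\le\infty$. (i) If $u\in\mathcal I^s_{p,q}(X)$, then $\mathrm{Tr}\,u=0$ $\mu$-a.e. (ii) If $u:X\to\mathbb C$ satisfies $|du|\in\mathcal I^s_{p,q}(X)$, then $u-P\,\mathrm{Tr}\,u\in\mathcal I^s_{p,q}(X)$ and $\|u-P\,\mathrm{Tr}\,u\|_{\mathcal I^s_{p,q}(X)}\le C'\|\,|du|\,\|_{\mathcal I^s_{p,q}(X)}$ with $C'$ independent of $u$. In particular, $\mathrm{Tr}\,u=\mathrm{Tr}(P\,\mathrm{Tr}\,u)$ $\mu$-a.e. (iii) If $f\in L^1_{\rm loc}(Z)$ and $|d(Pf)|\in\mathcal I^s_{p,q}(X)$, then $\mathrm{Tr}(Pf)=f$, with convergence in $L^1_{\rm loc}(Z)$ and pointwise $\mu$-a.e.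
   Context: $(Z,d,\mu)$ is a metric measure space, $\mu$ Borel regular, every ball has positive finite measure, and $\mu$ is doubling. Fix constants $C\ge1$, $Q>0$ with $\mu(B(\xi,\lambda r)) \le C\lambda^Q\mu(B(\xi,r))$ for all $\xi\in Z$, $r>0$, $\lambda\ge1$. Hyperbolic filling: for each $n\in\mathbb Z$ let $(\xi_x)_{x\in X_n}$ be a maximal set of points of $Z$ with pairwise distances at least $2^{-n-1}$; $X=\bigsqcup_n X_n$, $|x|:=n$ for $x\in X_n$, $B(x):=B(\xi_x,2^{-n})$. Distinct $x,x'\in X$ are neighbors, $x\sim x'$, iff $B(x)\cap B(x')\ne\emptyset$ and $||x|-|x'||\le1$. For $u:X\to\mathbb C$, $|du(x)| := \big(\sum_{x'\sim x}|u(x')-u(x)|^2\big)^{1/2}$. $\mathcal I^s_{p,q}(X)$: sequences $u:X\to\mathbb C$ with $\|u\|_{\mathcal I^s_{p,q}(X)} := \big(\sum_{k\in\mathbb Z}2^{ksq}\|\sum_{x\in X_k}|u(x)|\chi_{B(x)}\|_{L^p(Z)}^q\big)^{1/q}<\infty$ (usual modification for $p$ or $q=\infty$). $(\psi_x)_{x\in X}$: non-negative Lipschitz functions with $\psi_x$ supported in $B(x)$, $(\psi_x)_{x\in X_n}$ a partition of unity on $Z$ for each $n$, ${\rm Lip}\,\psi_x\le C''2^{|x|}$. $T_nu:=\sum_{x\in X_n}u(x)\psi_x$, and $\mathrm{Tr}\,u:=\lim_{n\to\infty}T_nu$ (in $L^1_{\rm loc}(Z)$ and $\mu$-a.e.;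 this limit exists under the hypothesis $|du|\in\mathcal I^s_{p,q}(X)$). For $f\in L^1_{\rm loc}(Z)$, $Pf(x):=\frac{1}{\mu(B(x))}\int_{B(x)}f\,d\mu$. *)

theory Defs
  imports "HOL-Analysis.Analysis"
begin

text \<open>Hyperbolic filling of a metric measure space. A vertex x of level n is encoded
  as the pair (n, xi) with xi in S n, where S n is the chosen maximal separated set.
  Thus |x| = fst x and B(x) = ball (snd x) (2 powr - fst x).\<close>

definition separated :: "real \<Rightarrow> 'z::metric_space set \<Rightarrow> bool" where
  "separated r A \<longleftrightarrow> (\<forall>a\<in>A. \<forall>b\<in>A. a \<noteq> b \<longrightarrow> r \<le> dist a b)"

definition maximal_separated :: "real \<Rightarrow> 'z::metric_space set \<Rightarrow> bool" where
  "maximal_separated r A \<longleftrightarrow> separated r A \<and> (\<forall>T. A \<subseteq> T \<and> separated r T \<longrightarrow> T = A)"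

definition filling :: "(int \<Rightarrow> 'z set) \<Rightarrow> (int \<times> 'z) set" where
  "filling S = Sigma UNIV S"

definition Bx :: "int \<times> 'z::metric_space \<Rightarrow> 'z set" where
  "Bx x = ball (snd x) (2 powr (- real_of_int (fst x)))"

definition neighbors :: "(int \<Rightarrow> 'z::metric_space set) \<Rightarrow> int \<times> 'z \<Rightarrow> (int \<times> 'z) set" where
  "neighbors S x = {x'\<in>filling S. x' \<noteq> x \<and> Bx x \<inter> Bx x' \<noteq> {} \<and> \<bar>fst x - fst x'\<bar> \<le> 1}"

text \<open>|du|(x); the neighbor set is finite under the doubling hypothesis.\<close>
definition dnorm :: "(int \<Rightarrow> 'z::metric_space set) \<Rightarrow> (int \<times> 'z \<Rightarrow> complex) \<Rightarrow> int \<times> 'z \<Rightarrow> real" where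
  "dnorm S u x = sqrt (\<Sum>x'\<in>neighbors S x. (cmod (u x' - u x))\<^sup>2)"

definition active :: "(int \<Rightarrow> 'z::metric_space set) \<Rightarrow> int \<Rightarrow> 'z \<Rightarrow> 'z set" where
  "active S n \<zeta> = {\<xi>\<in>S n. \<zeta> \<in> ball \<xi> (2 powr (- real_of_int n))}"

definition enn_rpow :: "ennreal \<Rightarrow> real \<Rightarrow> ennreal" where
  "enn_rpow x a = (if x = top then top else ennreal (enn2real x powr a))"

definition Lp_qnorm :: "'z measure \<Rightarrow> ereal \<Rightarrow> ('z \<Rightarrow> real) \<Rightarrow> ennreal" where
  "Lp_qnorm M p g =
     (if p = \<infinity> then Inf {c. AE \<zeta> in M. ennreal \<bar>g \<zeta>\<bar> \<le> c}
      else enn_rpow (\<integral>\<^sup>+\<zeta>. ennreal (\<bar>g \<zeta>\<bar> powr real_of_ereal p) \<partial>M) (1 / real_of_ereal p))"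

definition lev_fun :: "(int \<Rightarrow> 'z::metric_space set) \<Rightarrow> (int \<times> 'z \<Rightarrow> real) \<Rightarrow> int \<Rightarrow> 'z \<Rightarrow> real" where
  "lev_fun S u k \<zeta> = (\<Sum>\<xi>\<in>active S k \<zeta>. \<bar>u (k, \<xi>)\<bar>)"

definition I_qnorm :: "(int \<Rightarrow> 'z::metric_space set) \<Rightarrow> 'z measure \<Rightarrow> real \<Rightarrow> ereal \<Rightarrow> ereal
    \<Rightarrow> (int \<times> 'z \<Rightarrow> real) \<Rightarrow> ennreal" where
  "I_qnorm S M s p q u =
     (if q = \<infinity> then (SUP k::int. ennreal (2 powr (real_of_int k * s)) * Lp_qnorm M p (lev_fun S u k))
      else enn_rpow
        (infsum (\<lambda>k::int. ennreal (2 powr (real_of_int k * s * real_of_ereal q))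
                   * enn_rpow (Lp_qnorm M p (lev_fun S u k)) (real_of_ereal q)) UNIV)
        (1 / real_of_ereal q))"

definition I_mem :: "(int \<Rightarrow> 'z::metric_space set) \<Rightarrow> 'z measure \<Rightarrow> real \<Rightarrow> ereal \<Rightarrow> ereal
    \<Rightarrow> (int \<times> 'z \<Rightarrow> real) \<Rightarrow> bool" where
  "I_mem S M s p q u \<longleftrightarrow> I_qnorm S M s p q u < top"

text \<open>T_n u = sum_{x in X_n} u(x) psi_x (psi_x vanishes outside B(x)).\<close>
definition Tn :: "(int \<Rightarrow> 'z::metric_space set) \<Rightarrow> (int \<times> 'z \<Rightarrow> 'z \<Rightarrow> real) \<Rightarrow> int
    \<Rightarrow> (int \<times> 'z \<Rightarrow> complex) \<Rightarrow> 'z \<Rightarrow> complex" where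
  "Tn S \<psi> n u \<zeta> = (\<Sum>\<xi>\<in>active S n \<zeta>. u (n, \<xi>) * complex_of_real (\<psi> (n, \<xi>) \<zeta>))"

definition Tr :: "(int \<Rightarrow> 'z::metric_space set) \<Rightarrow> (int \<times> 'z \<Rightarrow> 'z \<Rightarrow> real)
    \<Rightarrow> (int \<times> 'z \<Rightarrow> complex) \<Rightarrow> 'z \<Rightarrow> complex" where
  "Tr S \<psi> u \<zeta> = lim (\<lambda>n::nat. Tn S \<psi> (int n) u \<zeta>)"

definition Pavg :: "'z::metric_space measure \<Rightarrow> ('z \<Rightarrow> complex) \<Rightarrow> int \<times> 'z \<Rightarrow> complex" where
  "Pavg M f x = set_lebesgue_integral M (Bx x) f / complex_of_real (measure M (Bx x))"

definition loc_integrable :: "'z::metric_space measure \<Rightarrow> ('z \<Rightarrow> complex) \<Rightarrow> bool" where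
  "loc_integrable M f \<longleftrightarrow> f \<in> borel_measurable M \<and>
     (\<forall>\<xi> r. 0 < r \<longrightarrow> set_integrable M (ball \<xi> r) f)"

end

theory Submission
  imports Defs
begin

text \<open>Write \<open>g k\<close> for the level-\<open>k\<close> function of \<open>|du|\<close>. On \<open>B(x)\<close> with \<open>|x| = n\<close> a telescoping
  argument gives \<open>|u(x) - Tr u| \<le> (\<Sum>j. g (n + j))\<close>, so \<open>|u(x) - P Tr u(x)|\<close> is at most the sum over
  \<open>j\<close> of the averages of \<open>g (n + j)\<close> over \<open>B(x)\<close>. Passing from these averages to the \<open>L\<^sup>p\<close> quasi-norm
  of \<open>g (n + j)\<close> costs nothing if \<open>p \<ge> 1\<close> and a factor \<open>2 powr (j * Q * (1/p - 1))\<close> if \<open>p < 1\<close>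
  (volume comparison); since \<open>p > Q / (Q + s)\<close>, this factor grows more slowly than \<open>2 powr (j * s)\<close>, and a
  discrete Hardy inequality in \<open>l\<^sup>q\<close> finishes the estimate. Part (iii) follows because
  \<open>T\<^sub>n (P f)\<close> tends to \<open>f\<close> locally in \<open>L\<^sup>1\<close> for every locally integrable \<open>f\<close> (uniform
  boundedness and density of Lipschitz functions), while the hypothesis gives convergence almost everywhere.\<close>

section \<open>Powers and quasi-norms with values in the extended non-negative reals\<close>

text \<open>The obstacle is that \<open>P Tr u\<close> has its intended meaning only if
  \<open>Tr u\<close> is locally integrable: a nonintegrable function has integral 0 in HOL, and for
  \<open>p < 1\<close> an \<open>L^p\<close> bound gives no integrability. The estimates are
  therefore run in \<open>ennreal\<close>, where averages always exist. The bound by a series of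
  averages is itself treated as a sequence on the filling; its quasi-norm is finite, so it is finite
  at every vertex, and only then does integrability of the trace on each ball follow. Small
  exponents also exclude the triangle inequality, in \<open>L^p\<close> as in \<open>l^q\<close>.
  Each interchange of a power with a series over levels instead gives away a factor
  \<open>2 powr (j * e)\<close> with an arbitrary \<open>e > 0\<close>. For finite \<open>p\<close>
  the hypothesis \<open>Q / (Q + s) < p\<close> says \<open>Q * (1 - p) < s * p\<close>, so there is
  a positive gap, and the values of \<open>e\<close> chosen below are fixed fractions of the gap at
  hand. In (iii) Fatou's lemma identifies the almost-everywhere limit with the local
  \<open>L^1\<close> limit.\<close>

lemma enn_rpow_ennreal: "0 \<le> x \<Longrightarrow> enn_rpow (ennreal x) a = ennreal (x powr a)"
  by (simp add: enn_rpow_def)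

lemma enn_rpow_top [simp]: "enn_rpow top a = top"
  by (simp add: enn_rpow_def)

lemma enn_rpow_0 [simp]: "enn_rpow 0 a = 0"
  by (simp add: enn_rpow_def)

lemma enn_rpow_1 [simp]: "enn_rpow x 1 = x"
  by (cases x) (simp_all add: enn_rpow_ennreal)

lemma enn_rpow_less_top: "enn_rpow x a < top \<longleftrightarrow> x < top"
  by (cases x) (simp_all add: enn_rpow_ennreal)

lemma enn_rpow_eq_0: "enn_rpow x a = 0 \<longleftrightarrow> x = 0"
  by (cases x) (auto simp add: enn_rpow_ennreal)

lemma enn_rpow_mult: "enn_rpow (x * y) a = enn_rpow x a * enn_rpow y a"
proof (cases "x = 0 \<or> y = 0")
  case False
  then show ?thesis
    by (cases x; cases y)
      (auto simp add: enn_rpow_ennreal ennreal_mult[symmetric] powr_mult ennreal_top_mult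
         ennreal_mult_top enn_rpow_eq_0)
qed auto

lemma enn_rpow_enn_rpow: "enn_rpow (enn_rpow x a) b = enn_rpow x (a * b)"
  by (cases x) (simp_all add: enn_rpow_ennreal powr_powr)

lemma enn_rpow_mono: "x \<le> y \<Longrightarrow> 0 \<le> a \<Longrightarrow> enn_rpow x a \<le> enn_rpow y a"
  by (cases x; cases y) (auto simp add: enn_rpow_ennreal powr_mono2 ennreal_leI top_unique)

lemma enn_rpow_inverse: "0 < a \<Longrightarrow> enn_rpow (enn_rpow x a) (1 / a) = x"
  by (simp add: enn_rpow_enn_rpow)

lemma enn_rpow_inverse': "0 < a \<Longrightarrow> enn_rpow (enn_rpow x (1 / a)) a = x"
  by (simp add: enn_rpow_enn_rpow)

lemma enn_rpow_measurable [measurable]: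
  assumes [measurable]: "f \<in> borel_measurable N"
  shows "(\<lambda>x. enn_rpow (f x) a) \<in> borel_measurable N"
proof -
  have "{x \<in> space N. f x = top} = f -` {top} \<inter> space N" by auto
  also have "\<dots> \<in> sets N" by (rule measurable_sets[OF assms]) simp
  finally have [measurable]: "Measurable.pred N (\<lambda>x. f x = top)"
    by (simp add: pred_def)
  show ?thesis unfolding enn_rpow_def by measurable
qed

text \<open>The quotients \<open>r / (r + t)\<close> and \<open>t / (r + t)\<close> lie in
  \<open>[0, 1]\<close> and add up to 1, and for \<open>a \<le> 1\<close> each is at most its
  \<open>a\<close>-th power.\<close>

lemma enn_rpow_add_le:
  assumes "0 < a" "a \<le> 1"
  shows "enn_rpow (x + y) a \<le> enn_rpow x a + enn_rpow y a"
proof (cases x; cases y)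
  fix r t assume x: "x = ennreal r" "0 \<le> r" and y: "y = ennreal t" "0 \<le> t"
  have "(r + t) powr a \<le> r powr a + t powr a"
  proof (cases "r + t = 0")
    case True
    then show ?thesis by simp
  next
    case False
    then have p: "0 < r + t" using x y by simp
    have *: "z / (r + t) \<le> z powr a / (r + t) powr a" if "0 \<le> z" "z \<le> r + t" for z
    proof -
      have "(z / (r + t)) powr 1 \<le> (z / (r + t)) powr a"
        using that p assms by (intro powr_mono') auto
      with that p show ?thesis by (simp add: powr_divide)
    qed
    have "1 = r / (r + t) + t / (r + t)" using p by (simp add: add_divide_distrib[symmetric])
    also have "\<dots> \<le> r powr a / (r + t) powr a + t powr a / (r + t) powr a"
      using x y add_mono[OF *[of r] *[of t]] by simp
    also have "\<dots> = (r powr a + t powr a) / (r + t) powr a"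
      by (simp add: add_divide_distrib)
    finally show ?thesis using p by (simp add: pos_le_divide_eq)
  qed
  then show ?thesis
    using x y by (simp add: enn_rpow_ennreal ennreal_plus[symmetric] ennreal_leI del: ennreal_plus)
qed auto

lemma enn_rpow_sum_le_subadd:
  assumes "0 < a" "a \<le> 1"
  shows "enn_rpow (sum c F) a \<le> (\<Sum>i\<in>F. enn_rpow (c i) a)"
proof (induction F rule: infinite_finite_induct)
  case (insert i F)
  then show ?case
    using enn_rpow_add_le[OF assms, of "c i" "sum c F"] by (auto intro: order_trans add_left_mono)
qed auto

text \<open>Every \<open>c i\<close> is at most \<open>X\<close>, the \<open>a\<close>-th root of
  the sum of \<open>a\<close>-th powers, so the sum is at most \<open>N * X\<close>. One argument
  serves all \<open>a > 0\<close>; it is applied to the boundedly many balls through a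
  point.\<close>

lemma enn_rpow_sum_le_card:
  fixes c :: "'a \<Rightarrow> ennreal"
  assumes "0 < a" "real (card F) \<le> N"
  shows "enn_rpow (sum c F) a \<le> ennreal (N powr a) * (\<Sum>i\<in>F. enn_rpow (c i) a)"
proof -
  define X where "X = enn_rpow (\<Sum>i\<in>F. enn_rpow (c i) a) (1 / a)"
  have "c i \<le> X" if "i \<in> F" "finite F" for i
  proof -
    have "enn_rpow (c i) a \<le> (\<Sum>i\<in>F. enn_rpow (c i) a)"
      using that by (intro member_le_sum) auto
    then show ?thesis unfolding X_def
      using enn_rpow_mono[of "enn_rpow (c i) a" _ "1 / a"] assms by (simp add: enn_rpow_inverse)
  qed
  then have "sum c F \<le> of_nat (card F) * X"
    by (cases "finite F") (auto intro: sum_bounded_above)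
  also have "\<dots> \<le> ennreal N * X"
    using assms by (intro mult_right_mono) (auto simp: ennreal_of_nat_eq_real_of_nat intro: ennreal_leI)
  finally have "enn_rpow (sum c F) a \<le> enn_rpow (ennreal N * X) a"
    using assms by (intro enn_rpow_mono) auto
  also have "\<dots> = ennreal (N powr a) * (\<Sum>i\<in>F. enn_rpow (c i) a)"
    using assms order_trans[OF of_nat_0_le_iff assms(2)]
    by (simp add: enn_rpow_mult X_def enn_rpow_inverse' enn_rpow_ennreal)
  finally show ?thesis .
qed

lemma suminf_geometric_powr:
  assumes "d < 0"
  shows "(\<Sum>j::nat. ennreal (2 powr (real j * d))) = ennreal (1 / (1 - 2 powr d))"
proof -
  have *: "(\<lambda>j. 2 powr (real j * d)) = (\<lambda>j. (2 powr d) ^ j)"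
    by (auto simp: powr_powr powr_realpow[symmetric] mult.commute)
  have "2 powr d < (1::real)" using assms by (simp add: powr_less_one)
  then have "(\<lambda>j. 2 powr (real j * d)) sums (1 / (1 - 2 powr d))"
    unfolding * by (intro geometric_sums) auto
  then show ?thesis by (intro suminf_ennreal_eq) auto
qed

text \<open>A substitute for the inequalities of Minkowski and Hoelder that does not care whether the
  exponent is below or above 1: since \<open>c j\<close> is at most \<open>2 powr (- j * e / a)\<close> times the
  \<open>a\<close>-th root of the right-hand sum, the sum of the \<open>c j\<close> is dominated by a geometric series.\<close>

lemma enn_rpow_suminf_le:
  fixes c :: "nat \<Rightarrow> ennreal"
  assumes "0 < a" "0 < e"
  shows "enn_rpow (\<Sum>j. c j) a \<le> ennreal ((1 / (1 - 2 powr (- e / a))) powr a)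
      * (\<Sum>j. ennreal (2 powr (real j * e)) * enn_rpow (c j) a)"
proof -
  define X where "X = (\<Sum>j. ennreal (2 powr (real j * e)) * enn_rpow (c j) a)"
  define K where "K = 1 / (1 - 2 powr (- e / a))"
  have K: "0 \<le> K"
    using powr_less_one[of 2 "- e / a"] assms by (auto simp: K_def)
  have c: "c j \<le> ennreal (2 powr (real j * (- e / a))) * enn_rpow X (1 / a)" for j
  proof -
    have "ennreal (2 powr (real j * e)) * enn_rpow (c j) a \<le> X"
      unfolding X_def using sum_le_suminf[of "\<lambda>j. ennreal (2 powr (real j * e)) * enn_rpow (c j) a" "{j}"]
      by (simp add: summableI)
    then have "ennreal (2 powr (- real j * e)) * (ennreal (2 powr (real j * e)) * enn_rpow (c j) a)
        \<le> ennreal (2 powr (- real j * e)) * X"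
      by (intro mult_left_mono) auto
    then have "enn_rpow (c j) a \<le> ennreal (2 powr (- real j * e)) * X"
      by (simp add: mult.assoc[symmetric] ennreal_mult[symmetric] powr_add[symmetric])
    then have "enn_rpow (enn_rpow (c j) a) (1 / a) \<le> enn_rpow (ennreal (2 powr (- real j * e)) * X) (1 / a)"
      using assms by (intro enn_rpow_mono) auto
    then show ?thesis
      using assms by (simp add: enn_rpow_inverse enn_rpow_mult enn_rpow_ennreal powr_powr)
  qed
  have "(\<Sum>j. c j) \<le> (\<Sum>j. ennreal (2 powr (real j * (- e / a))) * enn_rpow X (1 / a))"
    using c by (intro suminf_le) (auto intro: summableI)
  also have "\<dots> = ennreal K * enn_rpow X (1 / a)"
    using assms suminf_geometric_powr[of "- e / a"]
    by (simp only: ennreal_suminf_multc K_def divide_neg_pos neg_less_0_iff_less)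
  finally have "enn_rpow (\<Sum>j. c j) a \<le> enn_rpow (ennreal K * enn_rpow X (1 / a)) a"
    using assms by (intro enn_rpow_mono) auto
  also have "\<dots> = ennreal (K powr a) * X"
    using assms K by (simp add: enn_rpow_mult enn_rpow_inverse' enn_rpow_ennreal)
  finally show ?thesis by (simp add: K_def X_def)
qed

section \<open>Quasi-norms of extended-valued functions and of weighted sequences\<close>

lemma ennreal_powr_2_times: "ennreal (2 powr a) * ennreal (2 powr b) = ennreal (2 powr (a + b))"
  by (simp add: ennreal_mult[symmetric] powr_add)

text \<open>\<open>Lp_qnorm\<close> for functions that may take the value \<open>top\<close>: upper
  bounds by infinite series are measured before they are known to be finite.\<close>

definition Lp_enn :: "'z measure \<Rightarrow> ereal \<Rightarrow> ('z \<Rightarrow> ennreal) \<Rightarrow> ennreal" where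
  "Lp_enn M p g =
     (if p = \<infinity> then Inf {c. AE \<zeta> in M. g \<zeta> \<le> c}
      else enn_rpow (\<integral>\<^sup>+\<zeta>. enn_rpow (g \<zeta>) (real_of_ereal p) \<partial>M) (1 / real_of_ereal p))"

lemma Lp_qnorm_eq_Lp_enn: "Lp_qnorm M p g = Lp_enn M p (\<lambda>\<zeta>. ennreal \<bar>g \<zeta>\<bar>)"
  by (simp add: Lp_qnorm_def Lp_enn_def enn_rpow_ennreal)

text \<open>The infimum of the essential bounds is again one: it is the infimum of a sequence of
  them, and countably many null sets have a null union.\<close>

lemma AE_le_Lp_enn_infty:
  "AE \<zeta> in M. g \<zeta> \<le> Lp_enn M \<infinity> g"
proof -
  let ?A = "{c. AE \<zeta> in M. g \<zeta> \<le> c}"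
  have "top \<in> ?A" by simp
  then have "?A \<noteq> {}" by blast
  then obtain f where f: "\<And>i::nat. f i \<in> ?A" and lim: "Inf ?A = (INF i. f i)"
    using ennreal_Inf_countable_INF[of ?A] by (metis (no_types, lifting) image_subset_iff UNIV_I)
  have "AE \<zeta> in M. \<forall>i. g \<zeta> \<le> f i"
    using f by (subst AE_all_countable) auto
  then show ?thesis
    by eventually_elim (simp add: Lp_enn_def lim INF_greatest)
qed

text \<open>The outer sum of \<open>I_qnorm\<close> becomes an integral against counting measure, so
  that shifting the level and exchanging with a series are instances of integration rules.\<close>

definition lq_enn :: "real \<Rightarrow> ereal \<Rightarrow> (int \<Rightarrow> ennreal) \<Rightarrow> ennreal" where
  "lq_enn s q L =
     (if q = \<infinity> then (SUP k::int. ennreal (2 powr (real_of_int k * s)) * L k)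
      else enn_rpow
        (\<integral>\<^sup>+k. ennreal (2 powr (real_of_int k * s * real_of_ereal q))
                   * enn_rpow (L k) (real_of_ereal q) \<partial>count_space UNIV)
        (1 / real_of_ereal q))"

text \<open>The integral is the supremum of the partial sums along \<open>int_decode\<close>, hence
  at most \<open>infsum\<close>; conversely every finite partial sum is the integral over a smaller
  index set.\<close>

lemma infsum_int_eq_nn_integral:
  fixes f :: "int \<Rightarrow> ennreal"
  shows "infsum f UNIV = (\<integral>\<^sup>+k. f k \<partial>count_space UNIV)"
proof -
  have eq: "infsum f UNIV = (SUP F\<in>{F. finite F \<and> F \<subseteq> UNIV}. sum f F)"
    by (rule nonneg_infsum_complete) auto
  have "(\<integral>\<^sup>+k. f k \<partial>count_space UNIV) = (\<integral>\<^sup>+n. f (int_decode n) \<partial>count_space UNIV)"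
    by (rule nn_integral_bij_count_space[symmetric]) (rule bij_int_decode)
  also have "\<dots> = (SUP n. \<Sum>i<n. f (int_decode i))"
    by (simp add: nn_integral_count_space_nat suminf_eq_SUP)
  also have "\<dots> = (SUP n. sum f (int_decode ` {..<n}))"
    by (subst sum.reindex) (auto simp: inj_on_def dest: injD[OF inj_int_decode])
  also have "\<dots> \<le> infsum f UNIV"
    unfolding eq by (intro SUP_least SUP_upper) auto
  finally have 1: "(\<integral>\<^sup>+k. f k \<partial>count_space UNIV) \<le> infsum f UNIV" .
  have "sum f F \<le> (\<integral>\<^sup>+k. f k \<partial>count_space UNIV)" if "finite F" for F
  proof -
    have "sum f F = (\<integral>\<^sup>+k. f k \<partial>count_space F)"
      using that by (simp add: nn_integral_count_space_finite)
    also have "\<dots> \<le> (\<integral>\<^sup>+k. f k \<partial>count_space UNIV)"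
      by (auto simp: nn_integral_count_space_indicator intro!: nn_integral_mono split: split_indicator)
    finally show ?thesis .
  qed
  then have "infsum f UNIV \<le> (\<integral>\<^sup>+k. f k \<partial>count_space UNIV)"
    unfolding eq by (auto intro: SUP_least)
  with 1 show ?thesis by order
qed

lemma I_qnorm_eq_lq_enn: "I_qnorm S M s p q u = lq_enn s q (\<lambda>k. Lp_qnorm M p (lev_fun S u k))"
  by (simp add: I_qnorm_def lq_enn_def infsum_int_eq_nn_integral)

text \<open>The embedding of weighted \<open>l^q\<close> into weighted \<open>l^\<infinity>\<close>;
  it controls single levels for all \<open>q\<close> at once.\<close>

lemma le_lq_enn:
  assumes "0 < q"
  shows "ennreal (2 powr (real_of_int k * s)) * L k \<le> lq_enn s q L"
proof (cases "q = \<infinity>")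
  case True
  then show ?thesis by (auto simp: lq_enn_def intro!: SUP_upper2[of k])
next
  case False
  define r where "r = real_of_ereal q"
  have r: "0 < r" using False assms unfolding r_def by (cases q) auto
  have "enn_rpow (ennreal (2 powr (real_of_int k * s)) * L k) r
     = ennreal (2 powr (real_of_int k * s * r)) * enn_rpow (L k) r"
    by (simp add: enn_rpow_mult enn_rpow_ennreal powr_powr)
  also have "\<dots> \<le> (\<integral>\<^sup>+k. ennreal (2 powr (real_of_int k * s * r)) * enn_rpow (L k) r \<partial>count_space UNIV)"
    by (rule nn_integral_ge_point) auto
  finally have "enn_rpow (enn_rpow (ennreal (2 powr (real_of_int k * s)) * L k) r) (1 / r)
     \<le> enn_rpow (\<integral>\<^sup>+k. ennreal (2 powr (real_of_int k * s * r)) * enn_rpow (L k) r \<partial>count_space UNIV) (1 / r)"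
    using r by (intro enn_rpow_mono) auto
  then show ?thesis using False r by (simp add: lq_enn_def r_def enn_rpow_inverse)
qed

lemma lq_enn_less_topD:
  assumes "0 < q" "lq_enn s q L < top"
  shows "L k < top"
proof -
  have "ennreal (2 powr (real_of_int k * s)) * L k < top"
    using le_lq_enn[OF assms(1), of k s L] assms(2) by order
  then show ?thesis by (auto simp: ennreal_mult_less_top)
qed

text \<open>Discrete Hardy inequality. The weight of level \<open>n\<close> is
  \<open>2 powr (- j * s)\<close> times that of level \<open>n + j\<close>, which beats the growth
  \<open>2 powr (j * b)\<close>. As \<open>K'\<close> is obtained before \<open>A\<close> and
  \<open>L\<close> are named, it is uniform in both.\<close>

lemma lq_enn_hardy:
  assumes q: "0 < q" and bs: "b < s" and K: "0 \<le> (K::real)"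
  obtains K' :: real where "0 \<le> K'"
    "\<And>A L. (\<And>n. A n \<le> ennreal K * (\<Sum>j. ennreal (2 powr (real j * b)) * L (n + int j))) \<Longrightarrow>
        lq_enn s q A \<le> ennreal K' * lq_enn s q L"
proof (cases "q = \<infinity>")
  case True
  define G where "G = 1 / (1 - 2 powr (b - s))"
  have G0: "0 \<le> G" using powr_less_one[of 2 "b - s"] bs by (auto simp: G_def)
  have "lq_enn s q A \<le> ennreal (K * G) * lq_enn s q L"
    if A: "\<And>n. A n \<le> ennreal K * (\<Sum>j. ennreal (2 powr (real j * b)) * L (n + int j))" for A L
  proof -
    define X where "X = lq_enn s q L"
    have "ennreal (2 powr (real_of_int n * s)) * A n \<le> ennreal (K * G) * X" for n
    proof -
      have "ennreal (2 powr (real_of_int n * s)) * A n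
          \<le> ennreal (2 powr (real_of_int n * s)) * (ennreal K * (\<Sum>j. ennreal (2 powr (real j * b)) * L (n + int j)))"
        by (intro mult_left_mono A) auto
      also have "\<dots> = ennreal K * (\<Sum>j. ennreal (2 powr (real_of_int n * s)) * (ennreal (2 powr (real j * b)) * L (n + int j)))"
        by (simp add: mult.left_commute)
      also have "\<dots> \<le> ennreal K * (\<Sum>j. ennreal (2 powr (real j * (b - s))) * X)"
      proof (intro mult_left_mono suminf_le summableI)
        fix j :: nat
        have "ennreal (2 powr (real_of_int n * s)) * (ennreal (2 powr (real j * b)) * L (n + int j))
          = ennreal (2 powr (real j * (b - s))) * (ennreal (2 powr (real_of_int (n + int j) * s)) * L (n + int j))"
        proof -
          have "real_of_int n * s + real j * b = real j * (b - s) + real_of_int (n + int j) * s"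
            by (simp add: field_simps)
          then show ?thesis
            by (simp only: mult.assoc[symmetric] ennreal_powr_2_times)
        qed
        also have "\<dots> \<le> ennreal (2 powr (real j * (b - s))) * X"
          unfolding X_def by (intro mult_left_mono le_lq_enn q) auto
        finally show "ennreal (2 powr (real_of_int n * s)) * (ennreal (2 powr (real j * b)) * L (n + int j))
          \<le> ennreal (2 powr (real j * (b - s))) * X" .
      qed auto
      also have "\<dots> = ennreal (K * G) * X"
        using suminf_geometric_powr[of "b - s"] bs K G0
        by (simp only: ennreal_suminf_multc diff_less_0_iff_less G_def ennreal_mult mult.assoc)
      finally show ?thesis .
    qed
    then show ?thesis using True by (auto simp: lq_enn_def X_def intro!: SUP_least)
  qed
  then show ?thesis using that[of "K * G"] K G0 by auto
next
  case False
  define r where "r = real_of_ereal q"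
  have r: "0 < r" using False q unfolding r_def by (cases q) auto
  \<comment> \<open>Half of the gap \<open>(s - b) * r\<close>: opening the \<open>r\<close>-th
    power of the series costs \<open>2 powr (j * e)\<close>, and the other half leaves the summable
    factor \<open>2 powr (- j * e)\<close>.\<close>
  define e where "e = (s - b) * r / 2"
  have e: "0 < e" using bs r by (simp add: e_def)
  define K1 where "K1 = (1 / (1 - 2 powr (- e / r))) powr r"
  define G where "G = 1 / (1 - 2 powr (- e))"
  have G0: "0 \<le> G" using powr_less_one[of 2 "- e"] e by (auto simp: G_def)
  define K2 where "K2 = K powr r * K1 * G"
  have K2: "0 \<le> K2" using G0 by (simp add: K2_def K1_def)
  have "lq_enn s q A \<le> ennreal (K2 powr (1 / r)) * lq_enn s q L"
    if A: "\<And>n. A n \<le> ennreal K * (\<Sum>j. ennreal (2 powr (real j * b)) * L (n + int j))" for A L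
  proof -
    define Y where "Y k = ennreal (2 powr (real_of_int k * s * r)) * enn_rpow (L k) r" for k
    define X where "X = (\<integral>\<^sup>+k. Y k \<partial>count_space UNIV)"
    have An: "ennreal (2 powr (real_of_int n * s * r)) * enn_rpow (A n) r
        \<le> ennreal (K powr r * K1) * (\<Sum>j. ennreal (2 powr (real j * - e)) * Y (n + int j))" for n
    proof -
      have "enn_rpow (A n) r \<le> enn_rpow (ennreal K * (\<Sum>j. ennreal (2 powr (real j * b)) * L (n + int j))) r"
        using r by (intro enn_rpow_mono A) auto
      also have "\<dots> = ennreal (K powr r) * enn_rpow (\<Sum>j. ennreal (2 powr (real j * b)) * L (n + int j)) r"
        using K by (simp add: enn_rpow_mult enn_rpow_ennreal)
      also have "\<dots> \<le> ennreal (K powr r) * (ennreal K1 *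
          (\<Sum>j. ennreal (2 powr (real j * e)) * enn_rpow (ennreal (2 powr (real j * b)) * L (n + int j)) r))"
        unfolding K1_def using r e by (intro mult_left_mono enn_rpow_suminf_le) auto
      finally have "ennreal (2 powr (real_of_int n * s * r)) * enn_rpow (A n) r
         \<le> ennreal (2 powr (real_of_int n * s * r)) * (ennreal (K powr r) * (ennreal K1 *
          (\<Sum>j. ennreal (2 powr (real j * e)) * enn_rpow (ennreal (2 powr (real j * b)) * L (n + int j)) r)))"
        by (intro mult_left_mono) auto
      also have "\<dots> = ennreal (K powr r * K1) * (\<Sum>j. ennreal (2 powr (real_of_int n * s * r)) *
          (ennreal (2 powr (real j * e)) * enn_rpow (ennreal (2 powr (real j * b)) * L (n + int j)) r))"
        by (subst ennreal_suminf_cmult) (simp add: ennreal_mult' K1_def mult_ac)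
      also have "(\<lambda>j. ennreal (2 powr (real_of_int n * s * r)) *
          (ennreal (2 powr (real j * e)) * enn_rpow (ennreal (2 powr (real j * b)) * L (n + int j)) r))
          = (\<lambda>j. ennreal (2 powr (real j * - e)) * Y (n + int j))"
      proof
        fix j :: nat
        have "real_of_int n * s * r + (real j * e + real j * b * r)
            = real j * - e + real_of_int (n + int j) * s * r"
          unfolding e_def by (simp add: field_simps)
        then show "ennreal (2 powr (real_of_int n * s * r)) *
          (ennreal (2 powr (real j * e)) * enn_rpow (ennreal (2 powr (real j * b)) * L (n + int j)) r)
          = ennreal (2 powr (real j * - e)) * Y (n + int j)"
          unfolding Y_def
          by (simp only: enn_rpow_mult enn_rpow_ennreal powr_ge_zero powr_powr mult.assoc[symmetric]
              ennreal_powr_2_times add.assoc)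
      qed
      finally show ?thesis .
    qed
    have shift: "(\<integral>\<^sup>+n. Y (n + int j) \<partial>count_space UNIV) = X" for j
      unfolding X_def by (rule nn_integral_bij_count_space) (auto simp: bij_plus_right)
    have "(\<integral>\<^sup>+n. ennreal (2 powr (real_of_int n * s * r)) * enn_rpow (A n) r \<partial>count_space UNIV)
        \<le> (\<integral>\<^sup>+n. ennreal (K powr r * K1) * (\<Sum>j. ennreal (2 powr (real j * - e)) * Y (n + int j)) \<partial>count_space UNIV)"
      by (intro nn_integral_mono An)
    also have "\<dots> = ennreal (K powr r * K1) * (\<Sum>j. ennreal (2 powr (real j * - e)) * X)"
      by (simp add: nn_integral_cmult nn_integral_suminf shift)
    also have "\<dots> = ennreal (K powr r * K1) * (ennreal G * X)"
      using e by (simp only: ennreal_suminf_multc suminf_geometric_powr neg_less_0_iff_less G_def)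
    also have "\<dots> = ennreal K2 * X"
      using G0 by (simp add: K2_def K1_def ennreal_mult mult.assoc)
    finally have "enn_rpow (\<integral>\<^sup>+n. ennreal (2 powr (real_of_int n * s * r)) * enn_rpow (A n) r \<partial>count_space UNIV) (1 / r)
        \<le> enn_rpow (ennreal K2 * X) (1 / r)"
      using r by (intro enn_rpow_mono) auto
    then show ?thesis
      using False K2 by (simp add: lq_enn_def r_def X_def Y_def enn_rpow_mult enn_rpow_ennreal)
  qed
  then show ?thesis using that[of "K2 powr (1 / r)"] by auto
qed

section \<open>Geometry of the filling\<close>

abbreviation rad :: "int \<Rightarrow> real" where
  "rad n \<equiv> 2 powr (- real_of_int n)"

lemma rad_diff: "rad (n + int j) = rad n / 2 ^ j"
  by (simp add: powr_diff powr_realpow flip: powr_minus_divide)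

lemma ball_sets_borel [measurable]: "ball x r \<in> sets borel"
  by simp

locale doubling_filling =
  fixes M :: "'z::metric_space measure" and S :: "int \<Rightarrow> 'z set" and C Q :: real
  assumes space_M: "space M = UNIV"
    and sets_M [measurable_cong]: "sets M = sets borel"
    and balls_pos_fin: "\<And>\<xi> r. 0 < r \<Longrightarrow> 0 < emeasure M (ball \<xi> r) \<and> emeasure M (ball \<xi> r) < \<infinity>"
    and C_ge: "1 \<le> C" and Q_pos: "0 < Q"
    and doubling: "\<And>\<xi> r t. 0 < r \<Longrightarrow> 1 \<le> t \<Longrightarrow>
        measure M (ball \<xi> (t * r)) \<le> C * t powr Q * measure M (ball \<xi> r)"
    and S_max: "\<And>n. maximal_separated (2 powr (- real_of_int n - 1)) (S n)"
begin

lemma emeasure_ball_less_top: "emeasure M (ball \<xi> r) < top"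
  using balls_pos_fin[of r \<xi>] by (cases "0 < r") (auto simp: not_less ball_empty)

lemma emeasure_ball: "emeasure M (ball \<xi> r) = ennreal (measure M (ball \<xi> r))"
  using emeasure_ball_less_top[of \<xi> r] by (intro emeasure_eq_ennreal_measure) auto

lemma measure_ball_pos: "0 < r \<Longrightarrow> 0 < measure M (ball \<xi> r)"
  using balls_pos_fin[of r \<xi>] by (simp add: emeasure_ball)

lemma measure_mono_ball: "A \<in> sets M \<Longrightarrow> A \<subseteq> ball \<xi> r \<Longrightarrow> measure M A \<le> measure M (ball \<xi> r)"
  using emeasure_ball_less_top[of \<xi> r] by (intro measure_mono_fmeasurable fmeasurableI) (auto simp: sets_M)

lemma S_separated: "\<xi> \<in> S n \<Longrightarrow> \<eta> \<in> S n \<Longrightarrow> \<xi> \<noteq> \<eta> \<Longrightarrow> rad n / 2 \<le> dist \<xi> \<eta>"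
  using S_max[of n] by (auto simp: maximal_separated_def separated_def powr_diff)

text \<open>Adjoining an uncovered point would keep the set separated, so by maximality the point
  already belongs to \<open>S n\<close>; but it has distance 0 from itself.\<close>

lemma S_cover: "\<exists>\<xi>\<in>S n. dist \<xi> \<zeta> < rad n / 2"
proof (rule ccontr)
  assume "\<not> ?thesis"
  then have *: "\<And>\<xi>. \<xi> \<in> S n \<Longrightarrow> rad n / 2 \<le> dist \<xi> \<zeta>" by (auto simp: not_less)
  then have "separated (rad n / 2) (insert \<zeta> (S n))"
    using S_separated[of _ n] by (auto simp: separated_def dist_commute)
  moreover have "maximal_separated (rad n / 2) (S n)"
    using S_max[of n] by (simp add: powr_diff)
  ultimately have "insert \<zeta> (S n) = S n"
    unfolding maximal_separated_def by blast
  then show False using *[of \<zeta>] by auto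
qed

text \<open>\<open>8 * t + 8\<close> is the ratio of \<open>(2 * t + 2) * rad n\<close> to
  \<open>rad n / 4\<close>: a ball of the larger radius about a point within
  \<open>t * rad n\<close> of \<open>\<zeta>\<close> contains
  \<open>ball \<zeta> ((t + 1) * rad n)\<close>, which holds all the disjoint small balls.\<close>

definition cnt :: "real \<Rightarrow> real" where
  "cnt t = C * (8 * t + 8) powr Q"

lemma cnt_nonneg: "0 \<le> cnt t"
  using C_ge by (simp add: cnt_def)

text \<open>Volume counting: the balls of radius \<open>rad n / 4\<close> around the points of \<open>S n\<close> are disjoint.\<close>

lemma card_finite_S_le:
  assumes "0 \<le> t" "finite F" "F \<subseteq> {\<xi>\<in>S n. dist \<xi> \<zeta> < t * rad n}"
  shows "real (card F) \<le> cnt t"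
proof -
  let ?R = "(t + 1) * rad n"
  have R: "0 < ?R" using assms by (simp add: mult_pos_pos)
  have low: "measure M (ball \<zeta> ?R) \<le> cnt t * measure M (ball \<xi> (rad n / 4))" if "\<xi> \<in> F" for \<xi>
  proof -
    have d: "dist \<xi> \<zeta> < t * rad n" using that assms by auto
    have "measure M (ball \<zeta> ?R) \<le> measure M (ball \<xi> ((8 * t + 8) * (rad n / 4)))"
    proof (rule measure_mono_ball)
      show "ball \<zeta> ?R \<subseteq> ball \<xi> ((8 * t + 8) * (rad n / 4))"
      proof
        fix y assume "y \<in> ball \<zeta> ?R"
        then have "dist \<xi> y < t * rad n + ?R"
          using d dist_triangle[of \<xi> y \<zeta>] by simp
        also have "\<dots> \<le> (8 * t + 8) * (rad n / 4)" by (simp add: algebra_simps)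
        finally show "y \<in> ball \<xi> ((8 * t + 8) * (rad n / 4))" by simp
      qed
    qed (simp add: sets_M)
    also have "\<dots> \<le> C * (8 * t + 8) powr Q * measure M (ball \<xi> (rad n / 4))"
      using assms by (intro doubling) auto
    finally show ?thesis by (simp add: cnt_def)
  qed
  have disj: "disjoint_family_on (\<lambda>\<xi>. ball \<xi> (rad n / 4)) F"
    unfolding disjoint_family_on_def
  proof (intro ballI impI)
    fix \<xi> \<eta> assume "\<xi> \<in> F" "\<eta> \<in> F" "\<xi> \<noteq> \<eta>"
    then have "rad n / 2 \<le> dist \<xi> \<eta>" using assms by (intro S_separated) auto
    then show "ball \<xi> (rad n / 4) \<inter> ball \<eta> (rad n / 4) = {}"
      by (intro disjoint_ballI) simp
  qed
  have "real (card F) * measure M (ball \<zeta> ?R) = (\<Sum>\<xi>\<in>F. measure M (ball \<zeta> ?R))" by simp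
  also have "\<dots> \<le> (\<Sum>\<xi>\<in>F. cnt t * measure M (ball \<xi> (rad n / 4)))"
    by (intro sum_mono low)
  also have "\<dots> = cnt t * measure M (\<Union>\<xi>\<in>F. ball \<xi> (rad n / 4))"
    unfolding sum_distrib_left[symmetric] using emeasure_ball_less_top
    by (subst measure_finite_Union[OF \<open>finite F\<close> _ disj]) (auto simp: sets_M less_top[symmetric])
  also have "\<dots> \<le> cnt t * measure M (ball \<zeta> ?R)"
  proof (intro mult_left_mono measure_mono_ball cnt_nonneg)
    show "(\<Union>\<xi>\<in>F. ball \<xi> (rad n / 4)) \<subseteq> ball \<zeta> ?R"
    proof clarify
      fix \<xi> y assume "\<xi> \<in> F" "y \<in> ball \<xi> (rad n / 4)"
      then have "dist \<zeta> y < t * rad n + rad n / 4"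
        using assms dist_triangle[of \<zeta> y \<xi>] by (force simp: dist_commute)
      also have "\<dots> \<le> ?R" by (simp add: algebra_simps)
      finally show "y \<in> ball \<zeta> ?R" by simp
    qed
    show "(\<Union>\<xi>\<in>F. ball \<xi> (rad n / 4)) \<in> sets M"
      using \<open>finite F\<close> by (auto simp: sets_M)
  qed
  finally show ?thesis using measure_ball_pos[OF R, of \<zeta>] by simp
qed

text \<open>The bound on finite subsets excludes an infinite set. Finiteness also matters for
  meaning: a sum over an infinite index set is 0 in HOL, so without it \<open>lev_fun\<close>,
  \<open>Tn\<close> and \<open>dnorm\<close> would degenerate.\<close>

lemma finite_S_ball:
  assumes "0 \<le> t"
  shows "finite {\<xi>\<in>S n. dist \<xi> \<zeta> < t * rad n}"
proof (rule ccontr)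
  assume inf: "\<not> ?thesis"
  obtain m :: nat where m: "cnt t < real m" using reals_Archimedean2 by blast
  obtain F where "F \<subseteq> {\<xi>\<in>S n. dist \<xi> \<zeta> < t * rad n}" "finite F" "card F = m"
    using infinite_arbitrarily_large[OF inf] by blast
  then show False using card_finite_S_le[OF assms, of F n \<zeta>] m by auto
qed

lemma card_S_ball:
  "0 \<le> t \<Longrightarrow> real (card {\<xi>\<in>S n. dist \<xi> \<zeta> < t * rad n}) \<le> cnt t"
  by (intro card_finite_S_le finite_S_ball) auto

lemma active_eq: "active S n \<zeta> = {\<xi>\<in>S n. dist \<xi> \<zeta> < 1 * rad n}"
  by (auto simp: active_def)

lemma finite_active [simp]: "finite (active S n \<zeta>)"
  unfolding active_eq by (rule finite_S_ball) simp

lemma card_active: "real (card (active S n \<zeta>)) \<le> cnt 1"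
  unfolding active_eq by (rule card_S_ball) simp

lemma active_nonempty: "\<exists>\<xi>. \<xi> \<in> active S n \<zeta>"
proof -
  obtain \<xi> where "\<xi> \<in> S n" "dist \<xi> \<zeta> < rad n / 2" using S_cover by blast
  then have "dist \<xi> \<zeta> < rad n" by (elim less_le_trans) simp
  with \<open>\<xi> \<in> S n\<close> have "\<xi> \<in> active S n \<zeta>" unfolding active_def by simp
  then show ?thesis by blast
qed

lemma active_subset: "active S n \<zeta> \<subseteq> S n"
  by (auto simp: active_def)

text \<open>Countability permits exchanging integrals over \<open>M\<close> with sums over a level,
  and combining null sets over all balls of a level.\<close>

lemma countable_S: "countable (S n)"
proof -
  fix \<zeta> :: 'z
  have "S n \<subseteq> (\<Union>m::nat. {\<xi>\<in>S n. dist \<xi> \<zeta> < real m * rad n})"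
  proof
    fix \<xi> assume "\<xi> \<in> S n"
    obtain m :: nat where "dist \<xi> \<zeta> / rad n < real m" using reals_Archimedean2 by blast
    then have "dist \<xi> \<zeta> < real m * rad n" by (simp add: pos_divide_less_eq)
    then show "\<xi> \<in> (\<Union>m::nat. {\<xi>\<in>S n. dist \<xi> \<zeta> < real m * rad n})"
      using \<open>\<xi> \<in> S n\<close> by blast
  qed
  moreover have "countable (\<Union>m::nat. {\<xi>\<in>S n. dist \<xi> \<zeta> < real m * rad n})"
    by (intro countable_UN) (auto intro!: countable_finite finite_S_ball)
  ultimately show ?thesis by (rule countable_subset)
qed

text \<open>The ball about \<open>\<xi>\<close> of radius \<open>3 * rad n\<close> swallows the
  larger ball: at most one radius to a common point, two more across. The part
  \<open>2 powr (j * Q)\<close> of the doubling factor is the source of the loss for exponents below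
  1.\<close>

lemma measure_ball_compare:
  assumes "ball x (rad n) \<inter> ball \<xi> (rad (n + int j)) \<noteq> {}"
  shows "measure M (ball x (rad n)) \<le> C * 3 powr Q * 2 powr (real j * Q) * measure M (ball \<xi> (rad (n + int j)))"
proof -
  obtain z where z: "dist x z < rad n" "dist \<xi> z < rad (n + int j)" using assms by auto
  have le: "rad (n + int j) \<le> rad n" by simp
  have eq: "(3 * 2 ^ j) * rad (n + int j) = 3 * rad n" unfolding rad_diff by simp
  have "measure M (ball x (rad n)) \<le> measure M (ball \<xi> ((3 * 2 ^ j) * rad (n + int j)))"
  proof (rule measure_mono_ball)
    show "ball x (rad n) \<subseteq> ball \<xi> ((3 * 2 ^ j) * rad (n + int j))"
    proof
      fix y assume "y \<in> ball x (rad n)"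
      then have "dist x y < rad n" by simp
      then have "dist \<xi> y < 3 * rad n"
        using z le dist_triangle[of \<xi> y z] dist_triangle[of z y x] dist_commute[of z x] by linarith
      then show "y \<in> ball \<xi> ((3 * 2 ^ j) * rad (n + int j))" unfolding eq by simp
    qed
  qed (simp add: sets_M)
  also have "\<dots> \<le> C * (3 * 2 ^ j) powr Q * measure M (ball \<xi> (rad (n + int j)))"
  proof (intro doubling)
    have "1 \<le> (2::real) ^ j" by simp
    then show "1 \<le> 3 * (2::real) ^ j" by linarith
  qed simp
  also have "(3 * 2 ^ j) powr Q = 3 powr Q * (2 powr (real j * Q) :: real)"
  proof -
    have "(2::real) ^ j = 2 powr real j" by (simp add: powr_realpow)
    then show ?thesis by (simp only: powr_mult powr_powr)
  qed
  finally show ?thesis by (simp add: mult_ac)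
qed

section \<open>Measurability and integration of level functions\<close>

lemma AE_by_balls:
  assumes "\<And>\<xi>. \<xi> \<in> S n \<Longrightarrow> AE \<zeta> in M. \<zeta> \<in> ball \<xi> (rad n) \<longrightarrow> P \<zeta>"
  shows "AE \<zeta> in M. P \<zeta>"
proof -
  have "AE \<zeta> in M. \<forall>\<xi>\<in>S n. \<zeta> \<in> ball \<xi> (rad n) \<longrightarrow> P \<zeta>"
    using assms by (subst AE_ball_countable[OF countable_S]) auto
  then show ?thesis
  proof eventually_elim
    case (elim \<zeta>)
    then show ?case using active_nonempty[of n \<zeta>] by (auto simp: active_def)
  qed
qed

text \<open>Only countably many finite subsets of \<open>S n\<close> can occur as values, so it
  suffices that each fibre is measurable, and a fibre is a countable intersection of conditions on
  balls. Sums over a point-dependent index set thereby become measurable.\<close>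

lemma active_measurable:
  "active S n \<in> measurable M (count_space {F. finite F \<and> F \<subseteq> S n})"
proof (subst measurable_count_space_eq_countable)
  show "countable {F. finite F \<and> F \<subseteq> S n}"
    using countable_Collect_finite_subset[OF countable_S] .
  have "active S n -` {F} \<inter> space M \<in> sets M" if "F \<subseteq> S n" for F
  proof -
    have "active S n -` {F} \<inter> space M
      = {\<zeta>\<in>space M. \<forall>\<xi>\<in>S n. \<zeta> \<in> ball \<xi> (rad n) \<longleftrightarrow> \<xi> \<in> F}"
      using that unfolding active_def by blast
    also have "\<dots> \<in> sets M"
    proof (rule sets.sets_Collect_countable_All'[OF _ countable_S])
      fix \<xi>
      show "{\<zeta>\<in>space M. \<zeta> \<in> ball \<xi> (rad n) \<longleftrightarrow> \<xi> \<in> F} \<in> sets M"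
        by measurable
    qed
    finally show ?thesis .
  qed
  then show "active S n \<in> space M \<rightarrow> {F. finite F \<and> F \<subseteq> S n} \<and>
      (\<forall>F\<in>{F. finite F \<and> F \<subseteq> S n}. active S n -` {F} \<inter> space M \<in> sets M)"
    using finite_active active_subset by blast
qed

lemma sum_active_measurable:
  assumes "\<And>F. finite F \<Longrightarrow> F \<subseteq> S n \<Longrightarrow> (\<lambda>\<zeta>. \<Sum>\<xi>\<in>F. f \<xi> \<zeta>) \<in> measurable M N"
  shows "(\<lambda>\<zeta>. \<Sum>\<xi>\<in>active S n \<zeta>. f \<xi> \<zeta>) \<in> measurable M N"
  by (rule measurable_compose_countable'[OF _ active_measurable[of n]])
     (use assms countable_Collect_finite_subset[OF countable_S] in auto)

definition levE :: "int \<Rightarrow> ('z \<Rightarrow> ennreal) \<Rightarrow> 'z \<Rightarrow> ennreal" where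
  "levE n c \<zeta> = (\<Sum>\<xi>\<in>active S n \<zeta>. c \<xi>)"

lemma levE_measurable [measurable]: "levE n c \<in> borel_measurable M"
  unfolding levE_def[abs_def] by (rule sum_active_measurable) auto

text \<open>Indicators move the dependence on \<open>\<zeta>\<close> from the index set into the
  summand, which makes Tonelli's theorem available.\<close>

lemma levE_eq_nn_integral:
  "levE n c \<zeta> = (\<integral>\<^sup>+\<xi>. c \<xi> * indicator (ball \<xi> (rad n)) \<zeta> \<partial>count_space (S n))"
proof -
  have "levE n c \<zeta> = (\<integral>\<^sup>+\<xi>. c \<xi> \<partial>count_space (active S n \<zeta>))"
    by (simp add: levE_def nn_integral_count_space_finite)
  also have "\<dots> = (\<integral>\<^sup>+\<xi>. c \<xi> * indicator (ball \<xi> (rad n)) \<zeta> \<partial>count_space (S n))"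
    by (subst (1 2) nn_integral_count_space_indicator)
      (auto simp: active_def intro!: nn_integral_cong split: split_indicator)
  finally show ?thesis .
qed

lemma nn_integral_levE_mult:
  assumes [measurable]: "h \<in> borel_measurable M"
  shows "(\<integral>\<^sup>+\<zeta>. levE n c \<zeta> * h \<zeta> \<partial>M)
    = (\<integral>\<^sup>+\<xi>. c \<xi> * (\<integral>\<^sup>+\<zeta>. h \<zeta> * indicator (ball \<xi> (rad n)) \<zeta> \<partial>M) \<partial>count_space (S n))"
proof -
  have "(\<integral>\<^sup>+\<zeta>. levE n c \<zeta> * h \<zeta> \<partial>M)
    = (\<integral>\<^sup>+\<zeta>. (\<integral>\<^sup>+\<xi>. c \<xi> * (h \<zeta> * indicator (ball \<xi> (rad n)) \<zeta>) \<partial>count_space (S n)) \<partial>M)"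
    unfolding levE_eq_nn_integral
    by (intro nn_integral_cong, subst nn_integral_multc[symmetric]) (auto simp: mult_ac)
  also have "\<dots> = (\<integral>\<^sup>+\<xi>. (\<integral>\<^sup>+\<zeta>. c \<xi> * (h \<zeta> * indicator (ball \<xi> (rad n)) \<zeta>) \<partial>M) \<partial>count_space (S n))"
    by (rule nn_integral_count_space_nn_integral[OF countable_S]) measurable
  also have "\<dots> = (\<integral>\<^sup>+\<xi>. c \<xi> * (\<integral>\<^sup>+\<zeta>. h \<zeta> * indicator (ball \<xi> (rad n)) \<zeta> \<partial>M) \<partial>count_space (S n))"
    by (intro nn_integral_cong nn_integral_cmult) measurable
  finally show ?thesis .
qed

lemma nn_integral_levE:
  "(\<integral>\<^sup>+\<zeta>. levE n c \<zeta> \<partial>M) = (\<integral>\<^sup>+\<xi>. c \<xi> * emeasure M (ball \<xi> (rad n)) \<partial>count_space (S n))"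
  using nn_integral_levE_mult[of "\<lambda>_. 1" n c] by (simp add: sets_M)

lemma le_levE: "\<xi> \<in> active S n \<zeta> \<Longrightarrow> c \<xi> \<le> levE n c \<zeta>"
  unfolding levE_def by (rule member_le_sum) auto

lemma Lp_qnorm_lev_fun:
  "Lp_qnorm M p (lev_fun S u n) = Lp_enn M p (levE n (\<lambda>\<xi>. ennreal \<bar>u (n, \<xi>)\<bar>))"
  unfolding Lp_qnorm_eq_Lp_enn lev_fun_def levE_def
  by (simp add: sum_nonneg sum_ennreal)

end

section \<open>Averages over balls\<close>

text \<open>For \<open>x \<le> t\<close> the first summand suffices; for larger finite
  \<open>x\<close>, \<open>x powr (1 - p) \<le> t powr (1 - p)\<close> because the exponent is not
  positive. Integrated over a ball with a good \<open>t\<close>, this takes the place of Jensen's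
  inequality.\<close>

lemma le_add_powr_mult:
  assumes "0 < t" "1 \<le> p"
  shows "x \<le> ennreal t + ennreal (t powr (1 - p)) * enn_rpow x p"
proof (cases x)
  case (real r)
  have "r \<le> t + t powr (1 - p) * r powr p"
  proof (cases "r \<le> t")
    case True
    then show ?thesis by (simp add: add_increasing2)
  next
    case False
    then have r: "0 < r" using assms by simp
    have "r = r powr (1 - p) * r powr p" using r by (simp add: powr_add[symmetric])
    also have "\<dots> \<le> t powr (1 - p) * r powr p"
      using assms False by (intro mult_right_mono powr_mono2') auto
    finally show ?thesis using assms by simp
  qed
  then show ?thesis
    using real assms
    by (simp add: enn_rpow_ennreal ennreal_mult[symmetric] ennreal_plus[symmetric] ennreal_leI del: ennreal_plus)
next
  case top
  then show ?thesis using assms by (simp add: ennreal_mult_top)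
qed

context doubling_filling
begin

definition avgE :: "int \<Rightarrow> 'z \<Rightarrow> ('z \<Rightarrow> ennreal) \<Rightarrow> ennreal" where
  "avgE n \<xi> g = ennreal (1 / measure M (ball \<xi> (rad n))) *
     (\<integral>\<^sup>+\<zeta>. g \<zeta> * indicator (ball \<xi> (rad n)) \<zeta> \<partial>M)"

lemma avgE_measure:
  "ennreal (measure M (ball \<xi> (rad n))) * avgE n \<xi> g = (\<integral>\<^sup>+\<zeta>. g \<zeta> * indicator (ball \<xi> (rad n)) \<zeta> \<partial>M)"
  using measure_ball_pos[of "rad n" \<xi>]
  by (simp add: avgE_def mult.assoc[symmetric] ennreal_mult[symmetric])

text \<open>Integrate \<open>g \<le> t + t powr (1 - p) * g powr p\<close> over the ball, with \<open>t powr p\<close> the mean of \<open>g powr p\<close>.\<close>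

lemma avgE_pow_le_ge1:
  assumes p: "1 \<le> p" and [measurable]: "g \<in> borel_measurable M"
  shows "enn_rpow (avgE n \<xi> g) p * ennreal (measure M (ball \<xi> (rad n)))
    \<le> ennreal (2 powr p) * (\<integral>\<^sup>+\<zeta>. enn_rpow (g \<zeta>) p * indicator (ball \<xi> (rad n)) \<zeta> \<partial>M)"
proof -
  let ?B = "ball \<xi> (rad n)"
  define m where "m = measure M ?B"
  have m: "0 < m" unfolding m_def by (rule measure_ball_pos) simp
  define I where "I = (\<integral>\<^sup>+\<zeta>. enn_rpow (g \<zeta>) p * indicator ?B \<zeta> \<partial>M)"
  have "enn_rpow (avgE n \<xi> g) p * ennreal m \<le> ennreal (2 powr p) * I"
  \<comment> \<open>The balancing value of \<open>t\<close> would be 0 here, outside the range of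
    \<open>le_add_powr_mult\<close>; instead \<open>g\<close> vanishes almost everywhere on the
    ball.\<close>
  proof (cases "I = 0")
    case True
    then have "AE \<zeta> in M. enn_rpow (g \<zeta>) p * indicator ?B \<zeta> = 0"
      unfolding I_def by (subst (asm) nn_integral_0_iff_AE) auto
    then have "AE \<zeta> in M. g \<zeta> * indicator ?B \<zeta> = 0"
      by eventually_elim (auto simp: enn_rpow_eq_0 split: split_indicator_asm)
    then have "(\<integral>\<^sup>+\<zeta>. g \<zeta> * indicator ?B \<zeta> \<partial>M) = 0"
      by (subst nn_integral_0_iff_AE) auto
    then show ?thesis by (simp add: avgE_def)
  next
    case False
    show ?thesis
    proof (cases I)
      case top
      then show ?thesis by (simp add: ennreal_mult_top)
    next
      case (real i)
      then have i: "0 < i" using False by (cases "i = 0") auto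
      define t where "t = (i / m) powr (1 / p)"
      have t: "0 < t" using i m by (simp add: t_def)
      have tp: "t powr p * m = i" using i m p by (simp add: t_def powr_powr)
      have "(\<integral>\<^sup>+\<zeta>. g \<zeta> * indicator ?B \<zeta> \<partial>M)
          \<le> (\<integral>\<^sup>+\<zeta>. ennreal t * indicator ?B \<zeta> + ennreal (t powr (1 - p)) * (enn_rpow (g \<zeta>) p * indicator ?B \<zeta>) \<partial>M)"
        using le_add_powr_mult[OF t p] by (intro nn_integral_mono) (auto split: split_indicator)
      also have "\<dots> = ennreal t * emeasure M ?B + ennreal (t powr (1 - p)) * I"
        unfolding I_def by (subst nn_integral_add) (auto simp: nn_integral_cmult sets_M)
      also have "\<dots> = ennreal (t * m + t powr (1 - p) * i)"
        using t m i real by (simp add: emeasure_ball m_def[symmetric] ennreal_mult)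
      \<comment> \<open>Since \<open>t powr p * m = i\<close>, both terms equal
        \<open>t * m\<close>; this is where the factor \<open>2 powr p\<close> arises.\<close>
      also have "t * m + t powr (1 - p) * i = 2 * t * m"
        using t by (simp add: tp[symmetric] mult.assoc[symmetric] powr_add[symmetric])
      finally have "avgE n \<xi> g \<le> ennreal (1 / m) * ennreal (2 * t * m)"
        unfolding avgE_def m_def by (intro mult_left_mono) auto
      also have "\<dots> = ennreal (2 * t)" using m t by (simp add: ennreal_mult[symmetric])
      finally have "enn_rpow (avgE n \<xi> g) p \<le> enn_rpow (ennreal (2 * t)) p"
        using p by (intro enn_rpow_mono) auto
      then have "enn_rpow (avgE n \<xi> g) p * ennreal m \<le> enn_rpow (ennreal (2 * t)) p * ennreal m"
        by (intro mult_right_mono) auto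
      also have "\<dots> = ennreal (2 powr p * i)"
        using t m by (simp add: enn_rpow_ennreal tp[symmetric] powr_mult ennreal_mult''[symmetric] mult.assoc)
      finally show ?thesis using real by (simp add: ennreal_mult)
    qed
  qed
  then show ?thesis by (simp add: m_def I_def)
qed

text \<open>For \<open>p < 1\<close> the function must be one of level \<open>n + j\<close>: its integral is a finite sum over balls, to which
  subadditivity of the \<open>p\<close>-th power applies.\<close>

lemma avgE_pow_le_lt1:
  assumes p: "0 < p" "p < 1"
  defines "D \<equiv> C * 3 powr Q"
  shows "enn_rpow (avgE n \<xi> (levE (n + int j) c)) p * ennreal (measure M (ball \<xi> (rad n)))
    \<le> ennreal (D powr (1 - p) * 2 powr (real j * (Q * (1 - p))) * cnt 1)
       * (\<integral>\<^sup>+\<zeta>. enn_rpow (levE (n + int j) c \<zeta>) p * indicator (ball \<xi> (3 * rad n)) \<zeta> \<partial>M)"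
proof -
  define k where "k = n + int j"
  let ?B = "ball \<xi> (rad n)"
  define m where "m = measure M ?B"
  have m: "0 < m" unfolding m_def by (rule measure_ball_pos) simp
  define \<mu> where "\<mu> \<eta> = measure M (ball \<eta> (rad k))" for \<eta>
  have \<mu>: "0 < \<mu> \<eta>" for \<eta> unfolding \<mu>_def by (rule measure_ball_pos) simp
  have D: "0 < D" using C_ge by (simp add: D_def)
  have rk: "rad k \<le> rad n" by (simp add: k_def)
  define F where "F = {\<eta>\<in>S k. ball \<eta> (rad k) \<inter> ?B \<noteq> {}}"
  have finF: "finite F"
  proof (rule finite_subset)
    \<comment> \<open>The centres lie within \<open>2 * rad n\<close> of \<open>\<xi>\<close>,
      written in units of \<open>rad k\<close> to fit \<open>finite_S_ball\<close>. That ratio grows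
      with \<open>j\<close>, so only the finiteness of \<open>F\<close> is taken from here, not its
      size.\<close>
    show "F \<subseteq> {\<eta>\<in>S k. dist \<eta> \<xi> < (2 * rad n / rad k) * rad k}"
    proof
      fix \<eta> assume "\<eta> \<in> F"
      then obtain z where z: "\<eta> \<in> S k" "dist \<eta> z < rad k" "dist \<xi> z < rad n" by (auto simp: F_def)
      have "dist \<eta> \<xi> < 2 * rad n"
        using z rk dist_triangle2[of \<eta> \<xi> z] by linarith
      then show "\<eta> \<in> {\<eta>\<in>S k. dist \<eta> \<xi> < (2 * rad n / rad k) * rad k}"
        using z by simp
    qed
    show "finite {\<eta>\<in>S k. dist \<eta> \<xi> < (2 * rad n / rad k) * rad k}"
      by (rule finite_S_ball) simp
  qed
  have "(\<integral>\<^sup>+\<zeta>. levE k c \<zeta> * indicator ?B \<zeta> \<partial>M)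
    = (\<integral>\<^sup>+\<eta>. c \<eta> * (\<integral>\<^sup>+\<zeta>. indicator ?B \<zeta> * indicator (ball \<eta> (rad k)) \<zeta> \<partial>M) \<partial>count_space (S k))"
    by (rule nn_integral_levE_mult) measurable
  also have "\<dots> \<le> (\<integral>\<^sup>+\<eta>. c \<eta> * ennreal (\<mu> \<eta>) * indicator F \<eta> \<partial>count_space (S k))"
  proof (rule nn_integral_mono)
    fix \<eta> assume "\<eta> \<in> space (count_space (S k))"
    then have \<eta>: "\<eta> \<in> S k" by simp
    have le: "(\<integral>\<^sup>+\<zeta>. indicator ?B \<zeta> * indicator (ball \<eta> (rad k)) \<zeta> \<partial>M) \<le> ennreal (\<mu> \<eta>) * indicator F \<eta>"
    proof (cases "\<eta> \<in> F")
      case True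
      have "(\<integral>\<^sup>+\<zeta>. indicator ?B \<zeta> * indicator (ball \<eta> (rad k)) \<zeta> \<partial>M) \<le> (\<integral>\<^sup>+\<zeta>. indicator (ball \<eta> (rad k)) \<zeta> \<partial>M)"
        by (intro nn_integral_mono) (auto split: split_indicator)
      also have "\<dots> = ennreal (\<mu> \<eta>)"
        by (simp add: sets_M emeasure_ball \<mu>_def)
      finally show ?thesis using True by simp
    next
      case False
      then have "indicator ?B \<zeta> * indicator (ball \<eta> (rad k)) \<zeta> = (0::ennreal)" for \<zeta>
        using \<eta> by (auto simp: F_def split: split_indicator)
      then show ?thesis by (simp only: nn_integral_0_iff_AE nn_integral_const) simp
    qed
    then show "c \<eta> * (\<integral>\<^sup>+\<zeta>. indicator ?B \<zeta> * indicator (ball \<eta> (rad k)) \<zeta> \<partial>M)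
        \<le> c \<eta> * ennreal (\<mu> \<eta>) * indicator F \<eta>"
      unfolding mult.assoc by (intro mult_left_mono) auto
  qed
  also have "\<dots> = (\<Sum>\<eta>\<in>F. c \<eta> * ennreal (\<mu> \<eta>))"
  proof -
    have "(\<integral>\<^sup>+\<eta>. c \<eta> * ennreal (\<mu> \<eta>) * indicator F \<eta> \<partial>count_space (S k))
       = (\<integral>\<^sup>+\<eta>. c \<eta> * ennreal (\<mu> \<eta>) \<partial>count_space F)"
      by (subst (1 2) nn_integral_count_space_indicator)
        (auto simp: F_def intro!: nn_integral_cong split: split_indicator)
    then show ?thesis using finF by (simp add: nn_integral_count_space_finite)
  qed
  finally have int_le: "(\<integral>\<^sup>+\<zeta>. levE k c \<zeta> * indicator ?B \<zeta> \<partial>M) \<le> (\<Sum>\<eta>\<in>F. c \<eta> * ennreal (\<mu> \<eta>))" .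
  \<comment> \<open>Normalising the average leaves a factor \<open>m powr (1 - p)\<close>. The
    volume comparison, raised to the power \<open>1 - p > 0\<close>, trades it for
    \<open>\<mu> \<eta> powr (1 - p)\<close>, which restores the full measure of the small ball at
    the cost \<open>2 powr (j * (Q * (1 - p)))\<close>.\<close>
  have \<mu>_pow: "m powr (1 - p) * \<mu> \<eta> powr p \<le> D powr (1 - p) * 2 powr (real j * (Q * (1 - p))) * \<mu> \<eta>"
    if "\<eta> \<in> F" for \<eta>
  proof -
    have "m \<le> D * 2 powr (real j * Q) * \<mu> \<eta>"
      unfolding m_def D_def \<mu>_def k_def using that
      by (intro measure_ball_compare) (auto simp: F_def k_def)
    then have "m powr (1 - p) \<le> (D * 2 powr (real j * Q) * \<mu> \<eta>) powr (1 - p)"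
      using p m by (intro powr_mono2) auto
    also have "\<dots> = D powr (1 - p) * 2 powr (real j * (Q * (1 - p))) * \<mu> \<eta> powr (1 - p)"
      by (simp add: powr_mult powr_powr mult.assoc)
    finally have "m powr (1 - p) * \<mu> \<eta> powr p
        \<le> D powr (1 - p) * 2 powr (real j * (Q * (1 - p))) * \<mu> \<eta> powr (1 - p) * \<mu> \<eta> powr p"
      by (intro mult_right_mono) auto
    also have "\<dots> = D powr (1 - p) * 2 powr (real j * (Q * (1 - p))) * \<mu> \<eta>"
      using \<mu>[of \<eta>] by (simp add: mult.assoc powr_add[symmetric])
    finally show ?thesis .
  qed
  define T where "T = D powr (1 - p) * 2 powr (real j * (Q * (1 - p)))"
  have T: "0 \<le> T" by (simp add: T_def)
  have "enn_rpow (avgE n \<xi> (levE k c)) p * ennreal m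
     = ennreal ((1 / m) powr p * m) * enn_rpow (\<integral>\<^sup>+\<zeta>. levE k c \<zeta> * indicator ?B \<zeta> \<partial>M) p"
    using m by (simp add: avgE_def m_def[symmetric] enn_rpow_mult enn_rpow_ennreal ennreal_mult mult_ac
        del: powr_divide)
  also have "(1 / m) powr p * m = m powr (1 - p)"
    using m by (simp add: powr_divide powr_diff)
  also have "ennreal (m powr (1 - p)) * enn_rpow (\<integral>\<^sup>+\<zeta>. levE k c \<zeta> * indicator ?B \<zeta> \<partial>M) p
     \<le> ennreal (m powr (1 - p)) * (\<Sum>\<eta>\<in>F. enn_rpow (c \<eta> * ennreal (\<mu> \<eta>)) p)"
    using p int_le by (intro mult_left_mono order_trans[OF enn_rpow_mono enn_rpow_sum_le_subadd]) auto
  also have "\<dots> = (\<Sum>\<eta>\<in>F. enn_rpow (c \<eta>) p * ennreal (m powr (1 - p) * \<mu> \<eta> powr p))"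
    unfolding sum_distrib_left using \<mu>
    by (intro sum.cong) (auto simp: enn_rpow_mult enn_rpow_ennreal ennreal_mult mult_ac less_imp_le)
  also have "\<dots> \<le> (\<Sum>\<eta>\<in>F. enn_rpow (c \<eta>) p * ennreal (T * \<mu> \<eta>))"
    unfolding T_def using \<mu>_pow by (intro sum_mono mult_left_mono ennreal_leI) auto
  also have "\<dots> = ennreal T * (\<Sum>\<eta>\<in>F. enn_rpow (c \<eta>) p * ennreal (\<mu> \<eta>))"
    unfolding sum_distrib_left using \<mu> T
    by (intro sum.cong) (auto simp: ennreal_mult mult_ac less_imp_le)
  also have "(\<Sum>\<eta>\<in>F. enn_rpow (c \<eta>) p * ennreal (\<mu> \<eta>))
     = (\<integral>\<^sup>+\<zeta>. (\<Sum>\<eta>\<in>F. enn_rpow (c \<eta>) p * indicator (ball \<eta> (rad k)) \<zeta>) \<partial>M)"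
    by (subst nn_integral_sum) (auto simp: nn_integral_cmult sets_M emeasure_ball \<mu>_def)
  \<comment> \<open>At most \<open>cnt 1\<close> of the small balls contain a given point, each
    coefficient there is at most the level function, and every small ball meeting \<open>?B\<close>
    lies in the ball of triple radius.\<close>
  also have "\<dots> \<le> (\<integral>\<^sup>+\<zeta>. ennreal (cnt 1) * (enn_rpow (levE k c \<zeta>) p * indicator (ball \<xi> (3 * rad n)) \<zeta>) \<partial>M)"
  proof (rule nn_integral_mono)
    fix \<zeta>
    have "(\<Sum>\<eta>\<in>F. enn_rpow (c \<eta>) p * indicator (ball \<eta> (rad k)) \<zeta>)
        = (\<Sum>\<eta>\<in>F \<inter> active S k \<zeta>. enn_rpow (c \<eta>) p * indicator (ball \<eta> (rad k)) \<zeta>)"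
      using finF by (intro sum.mono_neutral_right) (auto simp: active_def F_def split: split_indicator_asm)
    also have "\<dots> \<le> (\<Sum>\<eta>\<in>F \<inter> active S k \<zeta>. enn_rpow (levE k c \<zeta>) p * indicator (ball \<xi> (3 * rad n)) \<zeta>)"
    proof (rule sum_mono)
      fix \<eta> assume \<eta>: "\<eta> \<in> F \<inter> active S k \<zeta>"
      then obtain z where z: "dist \<eta> z < rad k" "dist \<xi> z < rad n" by (auto simp: F_def)
      have "dist \<eta> \<zeta> < rad k" using \<eta> by (auto simp: active_def)
      then have "dist \<xi> \<zeta> < 3 * rad n"
        using z rk dist_triangle[of \<xi> \<zeta> z] dist_triangle[of z \<zeta> \<eta>] dist_commute[of z \<eta>] by linarith
      moreover have "enn_rpow (c \<eta>) p \<le> enn_rpow (levE k c \<zeta>) p"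
        using \<eta> p by (intro enn_rpow_mono le_levE) auto
      ultimately show "enn_rpow (c \<eta>) p * indicator (ball \<eta> (rad k)) \<zeta>
          \<le> enn_rpow (levE k c \<zeta>) p * indicator (ball \<xi> (3 * rad n)) \<zeta>"
        by (auto split: split_indicator)
    qed
    also have "\<dots> = of_nat (card (F \<inter> active S k \<zeta>)) * (enn_rpow (levE k c \<zeta>) p * indicator (ball \<xi> (3 * rad n)) \<zeta>)"
      by simp
    also have "\<dots> \<le> ennreal (cnt 1) * (enn_rpow (levE k c \<zeta>) p * indicator (ball \<xi> (3 * rad n)) \<zeta>)"
    proof (intro mult_right_mono)
      have "real (card (F \<inter> active S k \<zeta>)) \<le> real (card (active S k \<zeta>))"
        by (intro of_nat_mono card_mono) auto
      also have "\<dots> \<le> cnt 1" by (rule card_active)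
      finally show "of_nat (card (F \<inter> active S k \<zeta>)) \<le> ennreal (cnt 1)"
        unfolding ennreal_of_nat_eq_real_of_nat by (rule ennreal_leI)
    qed auto
    finally show "(\<Sum>\<eta>\<in>F. enn_rpow (c \<eta>) p * indicator (ball \<eta> (rad k)) \<zeta>)
      \<le> ennreal (cnt 1) * (enn_rpow (levE k c \<zeta>) p * indicator (ball \<xi> (3 * rad n)) \<zeta>)" .
  qed
  also have "\<dots> = ennreal (cnt 1) * (\<integral>\<^sup>+\<zeta>. enn_rpow (levE k c \<zeta>) p * indicator (ball \<xi> (3 * rad n)) \<zeta> \<partial>M)"
    by (rule nn_integral_cmult) measurable
  finally show ?thesis
    using T cnt_nonneg[of 1]
    by (simp add: T_def m_def k_def ennreal_mult mult.assoc mult_left_mono)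
qed

text \<open>The two ranges of \<open>p\<close> in one shape, with growth exponent 0 from
  \<open>p = 1\<close> on; the ball is tripled there as well, so that one overlap estimate covers
  both. \<open>K\<close> does not depend on the vertex, on \<open>j\<close> or on the
  coefficients.\<close>

lemma avgE_pow_le:
  assumes p: "0 < p"
  shows "\<exists>K::real. 0 \<le> K \<and> (\<forall>n j \<xi> c.
      enn_rpow (avgE n \<xi> (levE (n + int j) c)) p * ennreal (measure M (ball \<xi> (rad n)))
      \<le> ennreal (K * 2 powr (real j * max 0 (Q * (1 - p))))
         * (\<integral>\<^sup>+\<zeta>. enn_rpow (levE (n + int j) c \<zeta>) p * indicator (ball \<xi> (3 * rad n)) \<zeta> \<partial>M))"
proof (cases "p < 1")
  case True
  then have "max 0 (Q * (1 - p)) = Q * (1 - p)" using Q_pos by (simp add: max_def)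
  then show ?thesis
    using avgE_pow_le_lt1[OF p True] cnt_nonneg[of 1]
    by (intro exI[of _ "(C * 3 powr Q) powr (1 - p) * cnt 1"]) (simp add: mult_ac)
next
  case False
  then have "Q * (1 - p) \<le> 0" using Q_pos by (simp add: mult_le_0_iff)
  then have "max 0 (Q * (1 - p)) = 0" by simp
  moreover have "enn_rpow (avgE n \<xi> g) p * ennreal (measure M (ball \<xi> (rad n)))
    \<le> ennreal (2 powr p) * (\<integral>\<^sup>+\<zeta>. enn_rpow (g \<zeta>) p * indicator (ball \<xi> (3 * rad n)) \<zeta> \<partial>M)"
    if [measurable]: "g \<in> borel_measurable M" for n \<xi> g
  proof (rule order_trans[OF avgE_pow_le_ge1[OF _ that]])
    have "rad n \<le> 3 * rad n" by simp
    then have "ball \<xi> (rad n) \<subseteq> ball \<xi> (3 * rad n)" by (rule subset_ball)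
    then show "ennreal (2 powr p) * (\<integral>\<^sup>+\<zeta>. enn_rpow (g \<zeta>) p * indicator (ball \<xi> (rad n)) \<zeta> \<partial>M)
      \<le> ennreal (2 powr p) * (\<integral>\<^sup>+\<zeta>. enn_rpow (g \<zeta>) p * indicator (ball \<xi> (3 * rad n)) \<zeta> \<partial>M)"
      by (intro mult_left_mono nn_integral_mono) (auto split: split_indicator)
  qed (use False in auto)
  ultimately show ?thesis by (intro exI[of _ "2 powr p"]) simp
qed

text \<open>A point lies in at most \<open>cnt 3\<close> of the tripled balls, whatever the level;
  the rest is Tonelli.\<close>

lemma nn_integral_overlap_le:
  assumes [measurable]: "h \<in> borel_measurable M"
  shows "(\<integral>\<^sup>+\<xi>. (\<integral>\<^sup>+\<zeta>. h \<zeta> * indicator (ball \<xi> (3 * rad n)) \<zeta> \<partial>M) \<partial>count_space (S n))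
    \<le> ennreal (cnt 3) * (\<integral>\<^sup>+\<zeta>. h \<zeta> \<partial>M)"
proof -
  have "(\<integral>\<^sup>+\<xi>. (\<integral>\<^sup>+\<zeta>. h \<zeta> * indicator (ball \<xi> (3 * rad n)) \<zeta> \<partial>M) \<partial>count_space (S n))
     = (\<integral>\<^sup>+\<zeta>. (\<integral>\<^sup>+\<xi>. h \<zeta> * indicator (ball \<xi> (3 * rad n)) \<zeta> \<partial>count_space (S n)) \<partial>M)"
    by (rule nn_integral_count_space_nn_integral[OF countable_S, symmetric]) measurable
  also have "\<dots> \<le> (\<integral>\<^sup>+\<zeta>. ennreal (cnt 3) * h \<zeta> \<partial>M)"
  proof (rule nn_integral_mono)
    fix \<zeta>
    have "(\<integral>\<^sup>+\<xi>. h \<zeta> * indicator (ball \<xi> (3 * rad n)) \<zeta> \<partial>count_space (S n))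
       = (\<integral>\<^sup>+\<xi>. h \<zeta> \<partial>count_space {\<xi>\<in>S n. dist \<xi> \<zeta> < 3 * rad n})"
      by (subst (1 2) nn_integral_count_space_indicator)
        (auto intro!: nn_integral_cong split: split_indicator)
    also have "\<dots> = of_nat (card {\<xi>\<in>S n. dist \<xi> \<zeta> < 3 * rad n}) * h \<zeta>"
      using finite_S_ball[of 3 n \<zeta>] by (simp add: nn_integral_count_space_finite mult.commute)
    also have "\<dots> \<le> ennreal (cnt 3) * h \<zeta>"
      using card_S_ball[of 3 n \<zeta>]
      by (intro mult_right_mono) (auto simp: ennreal_of_nat_eq_real_of_nat intro: ennreal_leI)
    finally show "(\<integral>\<^sup>+\<xi>. h \<zeta> * indicator (ball \<xi> (3 * rad n)) \<zeta> \<partial>count_space (S n)) \<le> ennreal (cnt 3) * h \<zeta>" .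
  qed
  also have "\<dots> = ennreal (cnt 3) * (\<integral>\<^sup>+\<zeta>. h \<zeta> \<partial>M)"
    by (rule nn_integral_cmult) measurable
  finally show ?thesis .
qed

section \<open>From averages at a vertex to the quasi-norm of a whole level\<close>

lemma avgE_le_ess_bound:
  assumes "AE \<zeta> in M. g \<zeta> \<le> c"
  shows "avgE n \<xi> g \<le> c"
proof -
  have "(\<integral>\<^sup>+\<zeta>. g \<zeta> * indicator (ball \<xi> (rad n)) \<zeta> \<partial>M) \<le> (\<integral>\<^sup>+\<zeta>. c * indicator (ball \<xi> (rad n)) \<zeta> \<partial>M)"
    using assms by (intro nn_integral_mono_AE) (auto elim: eventually_mono split: split_indicator)
  also have "\<dots> = c * ennreal (measure M (ball \<xi> (rad n)))"
    by (simp add: nn_integral_cmult sets_M emeasure_ball)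
  finally have "avgE n \<xi> g \<le> ennreal (1 / measure M (ball \<xi> (rad n))) * (c * ennreal (measure M (ball \<xi> (rad n))))"
    unfolding avgE_def by (intro mult_left_mono) auto
  also have "\<dots> = c * (ennreal (1 / measure M (ball \<xi> (rad n))) * ennreal (measure M (ball \<xi> (rad n))))"
    by (simp only: mult_ac)
  also have "\<dots> = c"
    using measure_ball_pos[of "rad n" \<xi>] by (simp add: ennreal_mult[symmetric])
  finally show ?thesis .
qed

text \<open>The series over \<open>j\<close> is opened twice: under the \<open>p\<close>-th power,
  to integrate term by term, and under the \<open>p\<close>-th root, to return to quasi-norms.
  Bounded overlap turns the local integrals into global ones with a constant independent of
  \<open>j\<close>.\<close>

lemma Lp_enn_levE_le_finite:
  assumes p: "0 < p" and s: "max 0 (Q * (1 - p)) < s * p"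
  obtains K b :: real where "0 \<le> K" "b < s"
    "\<And>n c w. (\<And>\<xi>. \<xi> \<in> S n \<Longrightarrow> w \<xi> \<le> (\<Sum>j. avgE n \<xi> (levE (n + int j) (c (n + int j))))) \<Longrightarrow>
       Lp_enn M (ereal p) (levE n w) \<le> ennreal K *
         (\<Sum>j. ennreal (2 powr (real j * b)) * Lp_enn M (ereal p) (levE (n + int j) (c (n + int j))))"
proof -
  define \<tau> where "\<tau> = max 0 (Q * (1 - p))"
  obtain K0 where K0: "0 \<le> K0"
    "\<And>n j \<xi> c. enn_rpow (avgE n \<xi> (levE (n + int j) c)) p * ennreal (measure M (ball \<xi> (rad n)))
      \<le> ennreal (K0 * 2 powr (real j * \<tau>))
         * (\<integral>\<^sup>+\<zeta>. enn_rpow (levE (n + int j) c \<zeta>) p * indicator (ball \<xi> (3 * rad n)) \<zeta> \<partial>M)"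
    unfolding \<tau>_def using avgE_pow_le[OF p] by blast
  \<comment> \<open>A quarter of the gap between \<open>\<tau>\<close> and \<open>s * p\<close>: the
    two openings together add \<open>2 * e\<close> to the exponent \<open>b * p\<close>, which
    leaves half of the gap.\<close>
  define e where "e = (s * p - \<tau>) / 4"
  have e: "0 < e" using s by (simp add: e_def \<tau>_def)
  define e' where "e' = e / p"
  have e': "0 < e'" using e p by (simp add: e'_def)
  define b where "b = e' + (e + \<tau>) / p"
  have "b < s"
  proof -
    have "b * p = 2 * e + \<tau>" using p by (simp add: b_def e'_def field_simps)
    also have "\<dots> < s * p" using s unfolding e_def \<tau>_def[symmetric] by (simp add: field_simps)
    finally show ?thesis using p by simp
  qed
  define K1 where "K1 = (1 / (1 - 2 powr (- e / p))) powr p"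
  have K1: "0 \<le> K1" by (simp add: K1_def)
  define K2 where "K2 = (1 / (1 - 2 powr (- e' / (1 / p)))) powr (1 / p)"
  have K2: "0 \<le> K2" by (simp add: K2_def)
  define K3 where "K3 = cnt 1 powr p * (K1 * (K0 * cnt 3))"
  have K3: "0 \<le> K3" using K0 K1 cnt_nonneg by (simp add: K3_def)
  have main: "Lp_enn M (ereal p) (levE n w) \<le> ennreal (K3 powr (1 / p) * K2) *
         (\<Sum>j. ennreal (2 powr (real j * b)) * Lp_enn M (ereal p) (levE (n + int j) (c (n + int j))))"
    if w: "\<And>\<xi>. \<xi> \<in> S n \<Longrightarrow> w \<xi> \<le> (\<Sum>j. avgE n \<xi> (levE (n + int j) (c (n + int j))))" for n c w
  proof -
    define g where "g j = levE (n + int j) (c (n + int j))" for j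
    have [measurable]: "g j \<in> borel_measurable M" for j by (simp add: g_def)
    define I where "I j = (\<integral>\<^sup>+\<zeta>. enn_rpow (g j \<zeta>) p \<partial>M)" for j
    define J where "J j \<xi> = (\<integral>\<^sup>+\<zeta>. enn_rpow (g j \<zeta>) p * indicator (ball \<xi> (3 * rad n)) \<zeta> \<partial>M)" for j \<xi>
    have wp: "enn_rpow (w \<xi>) p * emeasure M (ball \<xi> (rad n))
        \<le> ennreal (K1 * K0) * (\<Sum>j. ennreal (2 powr (real j * (e + \<tau>))) * J j \<xi>)" if "\<xi> \<in> S n" for \<xi>
    proof -
      let ?m = "ennreal (measure M (ball \<xi> (rad n)))"
      have "enn_rpow (w \<xi>) p \<le> enn_rpow (\<Sum>j. avgE n \<xi> (g j)) p"
        using w[OF that] p by (intro enn_rpow_mono) (auto simp: g_def)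
      also have "\<dots> \<le> ennreal K1 * (\<Sum>j. ennreal (2 powr (real j * e)) * enn_rpow (avgE n \<xi> (g j)) p)"
        unfolding K1_def using p e by (intro enn_rpow_suminf_le)
      finally have "enn_rpow (w \<xi>) p * ?m
          \<le> ennreal K1 * (\<Sum>j. ennreal (2 powr (real j * e)) * enn_rpow (avgE n \<xi> (g j)) p) * ?m"
        by (intro mult_right_mono) auto
      also have "\<dots> = ennreal K1 * (\<Sum>j. ennreal (2 powr (real j * e)) * (enn_rpow (avgE n \<xi> (g j)) p * ?m))"
        unfolding mult.assoc ennreal_suminf_multc[symmetric] ..
      also have "\<dots> \<le> ennreal K1 * (\<Sum>j. ennreal (2 powr (real j * e)) * (ennreal (K0 * 2 powr (real j * \<tau>)) * J j \<xi>))"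
        unfolding J_def g_def by (intro mult_left_mono suminf_le K0 summableI) auto
      also have "\<dots> = ennreal K1 * (\<Sum>j. ennreal K0 * (ennreal (2 powr (real j * (e + \<tau>))) * J j \<xi>))"
      proof -
        have "ennreal (2 powr (real j * e)) * (ennreal (K0 * 2 powr (real j * \<tau>)) * J j \<xi>)
            = ennreal K0 * (ennreal (2 powr (real j * (e + \<tau>))) * J j \<xi>)" for j
          using K0(1) unfolding distrib_left ennreal_powr_2_times[symmetric]
          by (simp only: ennreal_mult powr_ge_zero mult_ac)
        then show ?thesis by (simp only:)
      qed
      also have "\<dots> = ennreal (K1 * K0) * (\<Sum>j. ennreal (2 powr (real j * (e + \<tau>))) * J j \<xi>)"
        using K0(1) K1 by (simp add: ennreal_mult mult.assoc)
      finally show ?thesis by (simp add: emeasure_ball)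
    qed
    have "(\<integral>\<^sup>+\<zeta>. enn_rpow (levE n w \<zeta>) p \<partial>M)
        \<le> (\<integral>\<^sup>+\<zeta>. ennreal (cnt 1 powr p) * levE n (\<lambda>\<xi>. enn_rpow (w \<xi>) p) \<zeta> \<partial>M)"
      unfolding levE_def using p by (intro nn_integral_mono enn_rpow_sum_le_card card_active)
    also have "\<dots> = ennreal (cnt 1 powr p) *
        (\<integral>\<^sup>+\<xi>. enn_rpow (w \<xi>) p * emeasure M (ball \<xi> (rad n)) \<partial>count_space (S n))"
      by (simp add: nn_integral_cmult nn_integral_levE)
    also have "\<dots> \<le> ennreal (cnt 1 powr p) *
        (\<integral>\<^sup>+\<xi>. ennreal (K1 * K0) * (\<Sum>j. ennreal (2 powr (real j * (e + \<tau>))) * J j \<xi>) \<partial>count_space (S n))"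
      using wp by (intro mult_left_mono nn_integral_mono) auto
    also have "\<dots> = ennreal (cnt 1 powr p) * (ennreal (K1 * K0) *
        (\<Sum>j. ennreal (2 powr (real j * (e + \<tau>))) * (\<integral>\<^sup>+\<xi>. J j \<xi> \<partial>count_space (S n))))"
      by (simp add: nn_integral_cmult nn_integral_suminf)
    also have "\<dots> \<le> ennreal (cnt 1 powr p) * (ennreal (K1 * K0) *
        (\<Sum>j. ennreal (2 powr (real j * (e + \<tau>))) * (ennreal (cnt 3) * I j)))"
      unfolding J_def I_def by (intro mult_left_mono suminf_le nn_integral_overlap_le summableI) auto
    also have "\<dots> = ennreal (cnt 1 powr p) * (ennreal (K1 * K0) *
        (\<Sum>j. ennreal (cnt 3) * (ennreal (2 powr (real j * (e + \<tau>))) * I j)))"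
      by (simp only: mult.left_commute)
    also have "\<dots> = ennreal K3 * (\<Sum>j. ennreal (2 powr (real j * (e + \<tau>))) * I j)"
      using K0(1) K1 cnt_nonneg[of 3] by (simp add: K3_def ennreal_mult mult.assoc)
    finally have "enn_rpow (\<integral>\<^sup>+\<zeta>. enn_rpow (levE n w \<zeta>) p \<partial>M) (1 / p)
        \<le> enn_rpow (ennreal K3 * (\<Sum>j. ennreal (2 powr (real j * (e + \<tau>))) * I j)) (1 / p)"
      using p by (intro enn_rpow_mono) auto
    also have "\<dots> = ennreal (K3 powr (1 / p)) * enn_rpow (\<Sum>j. ennreal (2 powr (real j * (e + \<tau>))) * I j) (1 / p)"
      using K3 by (simp add: enn_rpow_mult enn_rpow_ennreal)
    also have "\<dots> \<le> ennreal (K3 powr (1 / p)) * (ennreal K2 *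
        (\<Sum>j. ennreal (2 powr (real j * e')) * enn_rpow (ennreal (2 powr (real j * (e + \<tau>))) * I j) (1 / p)))"
      unfolding K2_def using p e' by (intro mult_left_mono enn_rpow_suminf_le) auto
    also have "\<dots> = ennreal (K3 powr (1 / p) * K2) *
        (\<Sum>j. ennreal (2 powr (real j * b)) * enn_rpow (I j) (1 / p))"
    proof -
      have "ennreal (2 powr (real j * e')) * enn_rpow (ennreal (2 powr (real j * (e + \<tau>))) * I j) (1 / p)
          = ennreal (2 powr (real j * b)) * enn_rpow (I j) (1 / p)" for j
      proof -
        have "real j * e' + real j * (e + \<tau>) * (1 / p) = real j * b"
          by (simp add: b_def algebra_simps add_divide_distrib)
        then show ?thesis
          by (simp only: enn_rpow_mult enn_rpow_ennreal powr_ge_zero powr_powr mult.assoc[symmetric]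
              ennreal_powr_2_times)
      qed
      then show ?thesis using K2 by (simp add: ennreal_mult mult.assoc)
    qed
    finally show ?thesis by (simp add: Lp_enn_def I_def g_def)
  qed
  show ?thesis
    by (rule that[OF _ \<open>b < s\<close> main]) (use K2 in auto)
qed

lemma Lp_enn_levE_le:
  assumes s: "0 < s" and p: "ereal (Q / (Q + s)) < p"
  obtains K b :: real where "0 \<le> K" "b < s"
    "\<And>n c w. (\<And>\<xi>. \<xi> \<in> S n \<Longrightarrow> w \<xi> \<le> (\<Sum>j. avgE n \<xi> (levE (n + int j) (c (n + int j))))) \<Longrightarrow>
       Lp_enn M p (levE n w) \<le> ennreal K *
         (\<Sum>j. ennreal (2 powr (real j * b)) * Lp_enn M p (levE (n + int j) (c (n + int j))))"
proof (cases p)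
  case (real r)
  have r: "Q / (Q + s) < r" using p real by simp
  have "0 < Q / (Q + s)" using Q_pos s by simp
  then have r0: "0 < r" using r by linarith
  \<comment> \<open>Rearranged, this is \<open>Q * (1 - r) < s * r\<close>: the volume loss stays
    below the gain from smoothness. Here the lower bound on \<open>p\<close> enters in full;
    elsewhere it only yields \<open>0 < p\<close>.\<close>
  have "Q < r * (Q + s)" using r Q_pos s by (simp add: pos_divide_less_eq)
  then have "max 0 (Q * (1 - r)) < s * r"
    using r0 s by (auto simp: max_def algebra_simps)
  from Lp_enn_levE_le_finite[OF r0 this] show ?thesis using that unfolding real by blast
next
  case PInf
  have "Lp_enn M \<infinity> (levE n w) \<le> ennreal (cnt 1) *
         (\<Sum>j. ennreal (2 powr (real j * 0)) * Lp_enn M \<infinity> (levE (n + int j) (c (n + int j))))"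
    if w: "\<And>\<xi>. \<xi> \<in> S n \<Longrightarrow> w \<xi> \<le> (\<Sum>j. avgE n \<xi> (levE (n + int j) (c (n + int j))))" for n c w
  proof -
    define X where "X = (\<Sum>j. Lp_enn M \<infinity> (levE (n + int j) (c (n + int j))))"
    have wX: "w \<xi> \<le> X" if "\<xi> \<in> S n" for \<xi>
    proof -
      have "(\<Sum>j. avgE n \<xi> (levE (n + int j) (c (n + int j)))) \<le> X"
        unfolding X_def by (intro suminf_le avgE_le_ess_bound AE_le_Lp_enn_infty summableI)
      then show ?thesis using w[OF that] by order
    qed
    have "levE n w \<zeta> \<le> ennreal (cnt 1) * X" for \<zeta>
    proof -
      have "levE n w \<zeta> \<le> of_nat (card (active S n \<zeta>)) * X"
        unfolding levE_def using wX active_subset by (intro sum_bounded_above) auto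
      also have "\<dots> \<le> ennreal (cnt 1) * X"
        using card_active[of n \<zeta>]
        by (intro mult_right_mono) (auto simp: ennreal_of_nat_eq_real_of_nat intro: ennreal_leI)
      finally show ?thesis .
    qed
    then show ?thesis by (auto simp: Lp_enn_def[of _ _ "levE n w"] X_def intro: Inf_lower)
  qed
  then show ?thesis
    using that[of "cnt 1" 0] cnt_nonneg s unfolding PInf by blast
next
  case MInf
  then show ?thesis using p by simp
qed


section \<open>Pointwise inequalities on the filling and summability of its levels\<close>

lemma avgE_mono_AE:
  assumes "AE \<zeta> in M. \<zeta> \<in> ball \<xi> (rad n) \<longrightarrow> f \<zeta> \<le> g \<zeta>"
  shows "avgE n \<xi> f \<le> avgE n \<xi> g"
  unfolding avgE_def using assms
  by (intro mult_left_mono nn_integral_mono_AE) (auto elim!: eventually_mono split: split_indicator)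

lemma avgE_suminf:
  assumes [measurable]: "\<And>j. g j \<in> borel_measurable M"
  shows "avgE n \<xi> (\<lambda>\<zeta>. \<Sum>j. g j \<zeta>) = (\<Sum>j. avgE n \<xi> (g j))"
proof -
  have "(\<integral>\<^sup>+\<zeta>. (\<Sum>j. g j \<zeta>) * indicator (ball \<xi> (rad n)) \<zeta> \<partial>M)
      = (\<Sum>j. \<integral>\<^sup>+\<zeta>. g j \<zeta> * indicator (ball \<xi> (rad n)) \<zeta> \<partial>M)"
    unfolding ennreal_suminf_multc[symmetric] by (rule nn_integral_suminf) measurable
  then show ?thesis unfolding avgE_def by simp
qed

text \<open>A constant is its own mean, so the difference is the mean of \<open>a - f\<close>.
  Integrability is essential, since otherwise the integral in \<open>Pavg\<close> is 0 by
  convention. With \<open>a = 0\<close> the mean itself is bounded.\<close>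

lemma cmod_diff_Pavg_le:
  assumes f: "set_integrable M (ball \<xi> (rad n)) f"
  shows "ennreal (cmod (a - Pavg M f (n, \<xi>))) \<le> avgE n \<xi> (\<lambda>\<zeta>. ennreal (cmod (a - f \<zeta>)))"
proof -
  let ?B = "ball \<xi> (rad n)"
  define m where "m = measure M ?B"
  have m: "0 < m" unfolding m_def by (rule measure_ball_pos) simp
  have const: "set_integrable M ?B (\<lambda>_. a)"
    using emeasure_ball_less_top[of \<xi> "rad n"]
    by (auto simp: set_integrable_def sets_M intro!: integrable_scaleR_left)
  have "(LINT \<zeta>:?B|M. a - f \<zeta>) = (LINT \<zeta>:?B|M. a) - (LINT \<zeta>:?B|M. f \<zeta>)"
    by (rule set_integral_diff(2)[OF const f])
  also have "(LINT \<zeta>:?B|M. a) = m *\<^sub>R a"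
    using emeasure_ball_less_top[of \<xi> "rad n"]
    by (simp add: set_integral_const sets_M m_def less_top[symmetric])
  finally have "a - Pavg M f (n, \<xi>) = (LINT \<zeta>:?B|M. a - f \<zeta>) / complex_of_real m"
    using m by (simp add: Pavg_def Bx_def m_def[symmetric] diff_divide_distrib scaleR_conv_of_real)
  then have "ennreal (cmod (a - Pavg M f (n, \<xi>)))
      = ennreal (1 / m) * ennreal (cmod (LINT \<zeta>:?B|M. a - f \<zeta>))"
    using m by (simp add: norm_divide ennreal_mult[symmetric])
  also have "\<dots> \<le> ennreal (1 / m) * (\<integral>\<^sup>+\<zeta>. ennreal (cmod (indicator ?B \<zeta> *\<^sub>R (a - f \<zeta>))) \<partial>M)"
    unfolding set_lebesgue_integral_def
    by (intro mult_left_mono integral_norm_bound_ennreal)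
      (use set_integral_diff(1)[OF const f] in \<open>auto simp: set_integrable_def\<close>)
  also have "(\<integral>\<^sup>+\<zeta>. ennreal (cmod (indicator ?B \<zeta> *\<^sub>R (a - f \<zeta>))) \<partial>M)
      = (\<integral>\<^sup>+\<zeta>. ennreal (cmod (a - f \<zeta>)) * indicator ?B \<zeta> \<partial>M)"
    by (intro nn_integral_cong) (auto split: split_indicator)
  finally show ?thesis by (simp add: avgE_def m_def)
qed

text \<open>Only three levels occur, and on level \<open>m\<close> the centres lie within
  \<open>rad n + rad m\<close> of \<open>\<xi>\<close>, which is \<open>t m\<close> in units of
  \<open>rad m\<close>. Hence the sum in \<open>dnorm\<close> is a genuine one.\<close>

lemma finite_neighbors: "finite (neighbors S x)"
proof -
  obtain n \<xi> where x: "x = (n, \<xi>)" by (cases x)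
  define t where "t m = (rad n + rad m) / rad m" for m
  have "neighbors S x \<subseteq> Sigma {n - 1, n, n + 1} (\<lambda>m. {\<eta>\<in>S m. dist \<eta> \<xi> < t m * rad m})"
  proof
    fix y assume y: "y \<in> neighbors S x"
    obtain m \<eta> where y': "y = (m, \<eta>)" by (cases y)
    obtain z where "dist \<xi> z < rad n" "dist \<eta> z < rad m"
      using y by (auto simp: neighbors_def Bx_def x y')
    then have "dist \<eta> \<xi> < t m * rad m"
      using dist_triangle2[of \<eta> \<xi> z] by (simp add: t_def)
    moreover have "m \<in> {n - 1, n, n + 1}" "\<eta> \<in> S m"
      using y by (auto simp: neighbors_def filling_def x y')
    ultimately show "y \<in> Sigma {n - 1, n, n + 1} (\<lambda>m. {\<eta>\<in>S m. dist \<eta> \<xi> < t m * rad m})"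
      by (simp add: y')
  qed
  moreover have "finite (Sigma {n - 1, n, n + 1} (\<lambda>m. {\<eta>\<in>S m. dist \<eta> \<xi> < t m * rad m}))"
    by (intro finite_SigmaI finite_S_ball) (auto simp: t_def)
  ultimately show ?thesis by (rule finite_subset)
qed

lemma dnorm_nonneg: "0 \<le> dnorm S u x"
  by (simp add: dnorm_def sum_nonneg)

text \<open>Two balls through \<open>\<zeta>\<close> on equal or adjacent levels belong to neighbors
  or to one vertex; for neighbors the squared difference is one term of the sum in
  \<open>dnorm\<close>.\<close>

lemma cmod_diff_le_dnorm:
  assumes "\<xi> \<in> active S n \<zeta>" "\<eta> \<in> active S m \<zeta>" "\<bar>n - m\<bar> \<le> 1"
  shows "cmod (u (m, \<eta>) - u (n, \<xi>)) \<le> dnorm S u (n, \<xi>)"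
proof (cases "(m, \<eta>) = (n, \<xi>)")
  case True
  then show ?thesis using dnorm_nonneg by simp
next
  case False
  have "\<zeta> \<in> Bx (n, \<xi>) \<inter> Bx (m, \<eta>)" using assms by (simp add: active_def Bx_def)
  then have "(m, \<eta>) \<in> neighbors S (n, \<xi>)"
    using assms False by (auto simp: neighbors_def filling_def active_def)
  then have "(cmod (u (m, \<eta>) - u (n, \<xi>)))\<^sup>2 \<le> (\<Sum>x'\<in>neighbors S (n, \<xi>). (cmod (u x' - u (n, \<xi>)))\<^sup>2)"
    using finite_neighbors by (intro member_le_sum) auto
  then show ?thesis unfolding dnorm_def by (rule real_le_rsqrt)
qed

lemma le_lev_fun: "\<xi> \<in> active S n \<zeta> \<Longrightarrow> \<bar>v (n, \<xi>)\<bar> \<le> lev_fun S v n \<zeta>"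
  unfolding lev_fun_def by (rule member_le_sum) auto

lemma lev_fun_nonneg: "0 \<le> lev_fun S v n \<zeta>"
  by (simp add: lev_fun_def sum_nonneg)

lemma ennreal_lev_fun: "ennreal (lev_fun S v n \<zeta>) = levE n (\<lambda>\<xi>. ennreal \<bar>v (n, \<xi>)\<bar>) \<zeta>"
  by (simp add: lev_fun_def levE_def)

text \<open>Only a uniform bound on the weighted levels enters, so one proof serves every
  \<open>q\<close>. On non-negative levels the weights grow, hence the quasi-norms decay; for finite
  \<open>p\<close>, half of this decay pays for opening the power of the series.\<close>

lemma AE_suminf_levE_finite:
  assumes s: "0 < s" and p: "0 < p"
    and X: "\<And>n. ennreal (2 powr (real_of_int n * s)) * Lp_enn M p (levE n (c n)) \<le> X" "X < top"
  shows "AE \<zeta> in M. (\<Sum>n. levE (int n) (c (int n)) \<zeta>) < top"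
proof -
  define h where "h n = levE (int n) (c (int n))" for n
  have [measurable]: "h n \<in> borel_measurable M" for n by (simp add: h_def)
  have L: "Lp_enn M p (h n) \<le> ennreal (2 powr (real n * - s)) * X" for n
  proof -
    have "ennreal (2 powr (real n * - s)) * (ennreal (2 powr (real n * s)) * Lp_enn M p (h n))
        \<le> ennreal (2 powr (real n * - s)) * X"
      using X(1)[of "int n"] by (intro mult_left_mono) (auto simp: h_def)
    then show ?thesis by (simp add: mult.assoc[symmetric] ennreal_powr_2_times)
  qed
  have sum_fin: "(\<Sum>n. ennreal (2 powr (real n * d)) * Y) < top" if "d < 0" "Y < top" for d Y
    using that by (simp only: ennreal_suminf_multc suminf_geometric_powr) (simp add: ennreal_mult_less_top)
  show ?thesis
  proof (cases "p = \<infinity>")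
    case True
    have "AE \<zeta> in M. \<forall>n. h n \<zeta> \<le> ennreal (2 powr (real n * - s)) * X"
      unfolding AE_all_countable
    proof
      fix n
      have "AE \<zeta> in M. h n \<zeta> \<le> Lp_enn M \<infinity> (h n)" by (rule AE_le_Lp_enn_infty)
      then show "AE \<zeta> in M. h n \<zeta> \<le> ennreal (2 powr (real n * - s)) * X"
        using L[of n] True by (auto elim!: eventually_mono intro: order_trans)
    qed
    then show ?thesis
    proof eventually_elim
      case (elim \<zeta>)
      then have "(\<Sum>n. h n \<zeta>) \<le> (\<Sum>n. ennreal (2 powr (real n * - s)) * X)"
        by (intro suminf_le summableI) auto
      also have "\<dots> < top" by (rule sum_fin) (use s X(2) in simp_all)
      finally show ?case by (simp add: h_def)
    qed
  next
    case False
    define r where "r = real_of_ereal p"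
    have r: "0 < r" using False p unfolding r_def by (cases p) auto
    define e where "e = s * r / 2"
    have e: "0 < e" using s r by (simp add: e_def)
    define K where "K = (1 / (1 - 2 powr (- e / r))) powr r"
    have int: "(\<integral>\<^sup>+\<zeta>. enn_rpow (h n \<zeta>) r \<partial>M) \<le> ennreal (2 powr (real n * - (s * r))) * enn_rpow X r" for n
    proof -
      have "(\<integral>\<^sup>+\<zeta>. enn_rpow (h n \<zeta>) r \<partial>M) = enn_rpow (Lp_enn M p (h n)) r"
        using False r by (simp add: Lp_enn_def r_def[symmetric] enn_rpow_inverse')
      also have "\<dots> \<le> enn_rpow (ennreal (2 powr (real n * - s)) * X) r"
        using r by (intro enn_rpow_mono L) auto
      also have "\<dots> = ennreal (2 powr (real n * - (s * r))) * enn_rpow X r"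
        by (simp add: enn_rpow_mult enn_rpow_ennreal powr_powr mult.assoc)
      finally show ?thesis .
    qed
    have "(\<integral>\<^sup>+\<zeta>. enn_rpow (\<Sum>n. h n \<zeta>) r \<partial>M)
        \<le> (\<integral>\<^sup>+\<zeta>. ennreal K * (\<Sum>n. ennreal (2 powr (real n * e)) * enn_rpow (h n \<zeta>) r) \<partial>M)"
      unfolding K_def using r e by (intro nn_integral_mono enn_rpow_suminf_le)
    also have "\<dots> = ennreal K * (\<Sum>n. ennreal (2 powr (real n * e)) * (\<integral>\<^sup>+\<zeta>. enn_rpow (h n \<zeta>) r \<partial>M))"
      by (simp add: nn_integral_cmult nn_integral_suminf)
    also have "\<dots> \<le> ennreal K * (\<Sum>n. ennreal (2 powr (real n * e)) *
        (ennreal (2 powr (real n * - (s * r))) * enn_rpow X r))"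
      by (intro mult_left_mono suminf_le int summableI) auto
    also have "\<dots> = ennreal K * (\<Sum>n. ennreal (2 powr (real n * - e)) * enn_rpow X r)"
    proof -
      have "real n * e + real n * - (s * r) = real n * - e" for n
        by (simp add: e_def field_simps)
      then show ?thesis by (simp only: mult.assoc[symmetric] ennreal_powr_2_times)
    qed
    also have "\<dots> < top"
      using sum_fin[of "- e" "enn_rpow X r"] e X(2)
      by (subst ennreal_mult_less_top) (simp add: enn_rpow_less_top del: ennreal_suminf_multc mult_minus_right)
    finally have "AE \<zeta> in M. enn_rpow (\<Sum>n. h n \<zeta>) r \<noteq> \<infinity>"
      by (intro nn_integral_noteq_infinite) auto
    then show ?thesis
    proof eventually_elim
      case (elim \<zeta>)
      then show ?case using enn_rpow_less_top[of "\<Sum>n. h n \<zeta>" r] by (simp add: less_top h_def)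
    qed
  qed
qed

text \<open>Used with \<open>v = |u|\<close> for the vanishing of the trace and with
  \<open>v = |du|\<close> for its existence.\<close>

lemma AE_summable_lev_fun:
  assumes s: "0 < s" and p: "0 < p" and q: "0 < q" and I: "I_mem S M s p q v"
  shows "AE \<zeta> in M. summable (\<lambda>n. lev_fun S v (int n) \<zeta>)"
proof -
  define c where "c n \<xi> = ennreal \<bar>v (n, \<xi>)\<bar>" for n \<xi>
  have "AE \<zeta> in M. (\<Sum>n. levE (int n) (c (int n)) \<zeta>) < top"
  proof (rule AE_suminf_levE_finite[OF s p])
    show "ennreal (2 powr (real_of_int n * s)) * Lp_enn M p (levE n (c n)) \<le> I_qnorm S M s p q v" for n
      unfolding I_qnorm_eq_lq_enn using le_lq_enn[OF q, of n s "\<lambda>k. Lp_qnorm M p (lev_fun S v k)"]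
      by (simp add: Lp_qnorm_lev_fun c_def[abs_def])
    show "I_qnorm S M s p q v < top" using I by (simp add: I_mem_def)
  qed
  then show ?thesis
  proof eventually_elim
    case (elim \<zeta>)
    then show ?case
      by (intro summable_suminf_not_top) (auto simp: lev_fun_nonneg ennreal_lev_fun c_def[abs_def])
  qed
qed

end

section \<open>The trace\<close>

locale filling_partition = doubling_filling +
  fixes \<psi> :: "int \<times> 'a::metric_space \<Rightarrow> 'a \<Rightarrow> real" and C'' :: real
  assumes psi_nonneg: "\<And>x \<zeta>. x \<in> filling S \<Longrightarrow> 0 \<le> \<psi> x \<zeta>"
    and psi_supp: "\<And>x \<zeta>. x \<in> filling S \<Longrightarrow> \<zeta> \<notin> Bx x \<Longrightarrow> \<psi> x \<zeta> = 0"
    and psi_lip: "\<And>x. x \<in> filling S \<Longrightarrow>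
        lipschitz_on (C'' * 2 powr real_of_int (fst x)) UNIV (\<psi> x)"
    and psi_pu: "\<And>n \<zeta>. (\<Sum>\<xi>\<in>active S n \<zeta>. \<psi> (n, \<xi>) \<zeta>) = 1"
begin

lemma psi_measurable: "\<xi> \<in> S n \<Longrightarrow> \<psi> (n, \<xi>) \<in> borel_measurable M"
  using lipschitz_on_continuous_on[OF psi_lip[of "(n, \<xi>)"]]
  by (simp add: filling_def borel_measurable_continuous_onI measurable_cong_sets[OF sets_M refl])

lemma psi_active_nonneg: "\<xi> \<in> active S n \<zeta> \<Longrightarrow> 0 \<le> \<psi> (n, \<xi>) \<zeta>"
  by (intro psi_nonneg) (auto simp: active_def filling_def)

lemma Tn_measurable [measurable]: "Tn S \<psi> n u \<in> borel_measurable M"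
  unfolding Tn_def[abs_def]
  by (rule sum_active_measurable) (use psi_measurable[of _ n] in measurable, auto)

lemma Tr_measurable [measurable]: "Tr S \<psi> u \<in> borel_measurable M"
  unfolding Tr_def[abs_def] by (rule borel_measurable_lim_metric) measurable

text \<open>Since the functions \<open>\<psi>\<close> of one level sum to 1, a constant may be
  subtracted inside the coefficients; the bounds on \<open>Tn\<close> below come from suitable
  choices of \<open>a\<close>.\<close>

lemma Tn_minus_const:
  "Tn S \<psi> n u \<zeta> - a = (\<Sum>\<xi>\<in>active S n \<zeta>. (u (n, \<xi>) - a) * complex_of_real (\<psi> (n, \<xi>) \<zeta>))"
proof -
  have "a = a * (\<Sum>\<xi>\<in>active S n \<zeta>. complex_of_real (\<psi> (n, \<xi>) \<zeta>))"
    by (simp flip: of_real_sum add: psi_pu)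
  then have "Tn S \<psi> n u \<zeta> - a = Tn S \<psi> n u \<zeta> - a * (\<Sum>\<xi>\<in>active S n \<zeta>. complex_of_real (\<psi> (n, \<xi>) \<zeta>))"
    by simp
  then show ?thesis
    by (simp add: Tn_def sum_distrib_left sum_subtractf left_diff_distrib)
qed

lemma cmod_Tn_minus_const_le_sum:
  "cmod (Tn S \<psi> n u \<zeta> - a) \<le> (\<Sum>\<xi>\<in>active S n \<zeta>. cmod (u (n, \<xi>) - a) * \<psi> (n, \<xi>) \<zeta>)"
  unfolding Tn_minus_const
  by (rule order_trans[OF norm_sum]) (simp add: norm_mult psi_active_nonneg)

text \<open>The value of \<open>Tn\<close> at \<open>\<zeta>\<close> is a convex combination of the
  values of \<open>u\<close> at the active vertices.\<close>

lemma cmod_Tn_minus_const_le: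
  assumes "\<And>\<xi>. \<xi> \<in> active S n \<zeta> \<Longrightarrow> cmod (u (n, \<xi>) - a) \<le> B"
  shows "cmod (Tn S \<psi> n u \<zeta> - a) \<le> B"
proof -
  have "cmod (Tn S \<psi> n u \<zeta> - a) \<le> (\<Sum>\<xi>\<in>active S n \<zeta>. cmod (u (n, \<xi>) - a) * \<psi> (n, \<xi>) \<zeta>)"
    by (rule cmod_Tn_minus_const_le_sum)
  also have "\<dots> \<le> (\<Sum>\<xi>\<in>active S n \<zeta>. B * \<psi> (n, \<xi>) \<zeta>)"
    using assms psi_active_nonneg by (intro sum_mono mult_right_mono)
  also have "\<dots> = B" by (simp add: sum_distrib_left[symmetric] psi_pu)
  finally show ?thesis .
qed

lemma cmod_Tn_le_lev_fun: "cmod (Tn S \<psi> n u \<zeta>) \<le> lev_fun S (\<lambda>x. cmod (u x)) n \<zeta>"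
  using cmod_Tn_minus_const_le[of n \<zeta> u 0 "lev_fun S (\<lambda>x. cmod (u x)) n \<zeta>"]
    le_lev_fun[of _ n \<zeta> "\<lambda>x. cmod (u x)"] by simp

text \<open>The level functions of \<open>|u|\<close> dominate \<open>Tn\<close> and are the terms
  of a convergent series.\<close>

lemma Tn_tendsto_0:
  assumes "0 < s" "0 < p" "0 < q" "I_mem S M s p q (\<lambda>x. cmod (u x))"
  shows "AE \<zeta> in M. (\<lambda>n::nat. Tn S \<psi> (int n) u \<zeta>) \<longlonglongrightarrow> 0"
  using AE_summable_lev_fun[OF assms]
proof eventually_elim
  case (elim \<zeta>)
  have "(\<lambda>n. lev_fun S (\<lambda>x. cmod (u x)) (int n) \<zeta>) \<longlonglongrightarrow> 0"
    using elim by (rule summable_LIMSEQ_zero)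
  then show ?case
    by (rule Lim_null_comparison[rotated]) (simp add: cmod_Tn_le_lev_fun)
qed

lemma cmod_Tn_Suc_diff_le:
  assumes "\<xi> \<in> active S n \<zeta>"
  shows "cmod (Tn S \<psi> (n + 1) u \<zeta> - u (n, \<xi>)) \<le> lev_fun S (dnorm S u) n \<zeta>"
proof (rule cmod_Tn_minus_const_le)
  fix \<eta> assume "\<eta> \<in> active S (n + 1) \<zeta>"
  then have "cmod (u (n + 1, \<eta>) - u (n, \<xi>)) \<le> dnorm S u (n, \<xi>)"
    using assms by (intro cmod_diff_le_dnorm) auto
  also have "\<dots> \<le> lev_fun S (dnorm S u) n \<zeta>"
    using le_lev_fun[OF assms, of "dnorm S u"] by simp
  finally show "cmod (u (n + 1, \<eta>) - u (n, \<xi>)) \<le> lev_fun S (dnorm S u) n \<zeta>" .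
qed

text \<open>Convexity once more, now over level \<open>n\<close>, with \<open>a\<close> the value of
  \<open>Tn\<close> on level \<open>n + 1\<close>.\<close>

lemma cmod_Tn_diff_le: "cmod (Tn S \<psi> (n + 1) u \<zeta> - Tn S \<psi> n u \<zeta>) \<le> lev_fun S (dnorm S u) n \<zeta>"
  unfolding norm_minus_commute[of "Tn S \<psi> (n + 1) u \<zeta>"]
  by (rule cmod_Tn_minus_const_le) (use cmod_Tn_Suc_diff_le in \<open>simp add: norm_minus_commute\<close>)

text \<open>Telescoping: passing from the vertex to level \<open>n + 1\<close> costs the level
  function of \<open>n\<close>, and each further level costs one more.\<close>

lemma cmod_Tn_add_diff_le:
  assumes "\<xi> \<in> active S n \<zeta>"
  shows "cmod (Tn S \<psi> (n + 1 + int j) u \<zeta> - u (n, \<xi>)) \<le> (\<Sum>i\<le>j. lev_fun S (dnorm S u) (n + int i) \<zeta>)"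
proof (induction j)
  case 0
  then show ?case using cmod_Tn_Suc_diff_le[OF assms] by simp
next
  case (Suc j)
  have "cmod (Tn S \<psi> (n + 1 + int (Suc j)) u \<zeta> - u (n, \<xi>))
    \<le> cmod (Tn S \<psi> (n + 1 + int j + 1) u \<zeta> - Tn S \<psi> (n + 1 + int j) u \<zeta>)
      + cmod (Tn S \<psi> (n + 1 + int j) u \<zeta> - u (n, \<xi>))"
    using norm_triangle_ineq[of "Tn S \<psi> (n + 1 + int j + 1) u \<zeta> - Tn S \<psi> (n + 1 + int j) u \<zeta>"
        "Tn S \<psi> (n + 1 + int j) u \<zeta> - u (n, \<xi>)"] by (simp add: algebra_simps)
  also have "\<dots> \<le> lev_fun S (dnorm S u) (n + 1 + int j) \<zeta> + (\<Sum>i\<le>j. lev_fun S (dnorm S u) (n + int i) \<zeta>)"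
    by (intro add_mono cmod_Tn_diff_le Suc)
  finally show ?case by (simp add: add_ac)
qed

lemma Tn_converges:
  assumes "summable (\<lambda>n. lev_fun S (dnorm S u) (int n) \<zeta>)"
  shows "(\<lambda>n::nat. Tn S \<psi> (int n) u \<zeta>) \<longlonglongrightarrow> Tr S \<psi> u \<zeta>"
proof -
  have "summable (\<lambda>n. Tn S \<psi> (int (Suc n)) u \<zeta> - Tn S \<psi> (int n) u \<zeta>)"
    using assms by (rule summable_comparison_test')
      (use cmod_Tn_diff_le[of "int _" u \<zeta>] in \<open>simp add: add_ac\<close>)
  then have "convergent (\<lambda>n. \<Sum>i<n. Tn S \<psi> (int (Suc i)) u \<zeta> - Tn S \<psi> (int i) u \<zeta>)"
    by (simp only: summable_iff_convergent)
  then have "convergent (\<lambda>n. Tn S \<psi> (int n) u \<zeta> - Tn S \<psi> (int 0) u \<zeta>)"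
    by (simp only: sum_lessThan_telescope[of "\<lambda>n. Tn S \<psi> (int n) u \<zeta>"])
  then have "convergent (\<lambda>n. Tn S \<psi> (int n) u \<zeta>)"
    unfolding convergent_diff_const_right_iff .
  then show ?thesis unfolding Tr_def by (rule convergent_LIMSEQ_iff[THEN iffD1])
qed

lemma cmod_Tr_diff_le:
  assumes lim: "(\<lambda>n::nat. Tn S \<psi> (int n) u \<zeta>) \<longlonglongrightarrow> Tr S \<psi> u \<zeta>" and \<xi>: "\<xi> \<in> active S n \<zeta>"
  shows "ennreal (cmod (u (n, \<xi>) - Tr S \<psi> u \<zeta>))
    \<le> (\<Sum>j. levE (n + int j) (\<lambda>\<eta>. ennreal (dnorm S u (n + int j, \<eta>))) \<zeta>)"
proof -
  \<comment> \<open>\<open>Tr\<close> is a limit along natural numbers, while \<open>n\<close> may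
    be negative. The shift by \<open>a\<close> makes \<open>n + 1 + int a\<close> non-negative, so
    dropping initial terms leaves exactly the levels \<open>n + 1 + int (j + 2 * a)\<close>.\<close>
  define a where "a = nat \<bar>n + 1\<bar>"
  have "(\<lambda>j. Tn S \<psi> (int (j + (a + nat (n + 1 + int a)))) u \<zeta>) \<longlonglongrightarrow> Tr S \<psi> u \<zeta>"
    by (rule LIMSEQ_ignore_initial_segment[OF lim])
  moreover have "int (j + (a + nat (n + 1 + int a))) = n + 1 + int (j + 2 * a)" for j
    by (simp add: a_def)
  ultimately have "(\<lambda>j. Tn S \<psi> (n + 1 + int (j + 2 * a)) u \<zeta>) \<longlonglongrightarrow> Tr S \<psi> u \<zeta>"
    by (simp only:)
  then have l: "(\<lambda>j. ennreal (cmod (Tn S \<psi> (n + 1 + int (j + 2 * a)) u \<zeta> - u (n, \<xi>))))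
      \<longlonglongrightarrow> ennreal (cmod (Tr S \<psi> u \<zeta> - u (n, \<xi>)))"
    by (intro tendsto_intros)
  have "ennreal (cmod (Tr S \<psi> u \<zeta> - u (n, \<xi>)))
    \<le> (\<Sum>j. levE (n + int j) (\<lambda>\<eta>. ennreal (dnorm S u (n + int j, \<eta>))) \<zeta>)"
  proof (rule LIMSEQ_le_const2[OF l], intro exI allI impI)
    fix j
    define N where "N = j + 2 * a"
    have "ennreal (cmod (Tn S \<psi> (n + 1 + int N) u \<zeta> - u (n, \<xi>)))
      \<le> ennreal (\<Sum>i\<le>N. lev_fun S (dnorm S u) (n + int i) \<zeta>)"
      by (intro ennreal_leI cmod_Tn_add_diff_le \<xi>)
    also have "\<dots> = (\<Sum>i\<le>N. levE (n + int i) (\<lambda>\<eta>. ennreal (dnorm S u (n + int i, \<eta>))) \<zeta>)"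
      by (simp add: sum_ennreal[symmetric] lev_fun_nonneg ennreal_lev_fun dnorm_nonneg)
    also have "\<dots> \<le> (\<Sum>i. levE (n + int i) (\<lambda>\<eta>. ennreal (dnorm S u (n + int i, \<eta>))) \<zeta>)"
      by (intro sum_le_suminf summableI) auto
    finally show "ennreal (cmod (Tn S \<psi> (n + 1 + int (j + 2 * a)) u \<zeta> - u (n, \<xi>)))
      \<le> (\<Sum>j. levE (n + int j) (\<lambda>\<eta>. ennreal (dnorm S u (n + int j, \<eta>))) \<zeta>)"
      by (simp only: N_def)
  qed
  then show ?thesis by (simp add: norm_minus_commute)
qed

end

context doubling_filling
begin

section \<open>Finiteness of coefficients, and the estimate across all levels\<close>

lemma AE_less_top_of_Lp_enn:
  assumes p: "0 < p" and [measurable]: "h \<in> borel_measurable M" and fin: "Lp_enn M p h < top"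
  shows "AE \<zeta> in M. h \<zeta> < top"
proof (cases "p = \<infinity>")
  case True
  then show ?thesis using AE_le_Lp_enn_infty[where M = M and g = h] fin by (auto elim!: eventually_mono)
next
  case False
  define r where "r = real_of_ereal p"
  have r: "0 < r" using False p unfolding r_def by (cases p) auto
  have "(\<integral>\<^sup>+\<zeta>. enn_rpow (h \<zeta>) r \<partial>M) < top"
    using fin False by (simp add: Lp_enn_def r_def enn_rpow_less_top)
  then have "AE \<zeta> in M. enn_rpow (h \<zeta>) r \<noteq> \<infinity>"
    by (intro nn_integral_noteq_infinite) auto
  then show ?thesis
  proof eventually_elim
    case (elim \<zeta>)
    then show ?case using enn_rpow_less_top[of "h \<zeta>" r] by (simp add: less_top)
  qed
qed

text \<open>An infinite coefficient makes the level function infinite on a ball of positive measure,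
  which a finite quasi-norm forbids.\<close>

lemma less_top_of_Lp_enn_levE:
  assumes p: "0 < p" and fin: "Lp_enn M p (levE n w) < top" and \<xi>: "\<xi> \<in> S n"
  shows "w \<xi> < top"
proof (rule ccontr)
  assume "\<not> w \<xi> < top"
  then have top: "w \<xi> = top" by (simp add: not_less top_unique)
  have "AE \<zeta> in M. levE n w \<zeta> < top"
    using p fin by (intro AE_less_top_of_Lp_enn) auto
  then have "AE \<zeta> in M. \<zeta> \<notin> ball \<xi> (rad n)"
  proof eventually_elim
    case (elim \<zeta>)
    show ?case
    proof
      assume "\<zeta> \<in> ball \<xi> (rad n)"
      then have "w \<xi> \<le> levE n w \<zeta>" using \<xi> by (intro le_levE) (simp add: active_def)
      then show False using elim top by simp
    qed
  qed
  then have "(\<integral>\<^sup>+\<zeta>. indicator (ball \<xi> (rad n)) \<zeta> \<partial>M) = 0"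
    by (subst nn_integral_0_iff_AE) (auto elim!: eventually_mono)
  then have "emeasure M (ball \<xi> (rad n)) = 0"
    by (subst (asm) nn_integral_indicator) (simp_all add: sets_M)
  then show False using balls_pos_fin[of "rad n" \<xi>] by simp
qed

text \<open>The estimate within each level supplies the premise of the Hardy inequality.
  \<open>K\<close> is fixed before \<open>c\<close> and \<open>w\<close>, which later makes the
  constant independent of \<open>u\<close>.\<close>

lemma lq_Lp_avgE_le:
  assumes s: "0 < s" and p: "ereal (Q / (Q + s)) < p" and q: "0 < q"
  obtains K :: real where "0 \<le> K"
    "\<And>c w. (\<And>n \<xi>. \<xi> \<in> S n \<Longrightarrow> w n \<xi> \<le> (\<Sum>j. avgE n \<xi> (levE (n + int j) (c (n + int j))))) \<Longrightarrow>
       lq_enn s q (\<lambda>n. Lp_enn M p (levE n (w n))) \<le> ennreal K * lq_enn s q (\<lambda>n. Lp_enn M p (levE n (c n)))"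
proof -
  obtain K0 b where K0: "0 \<le> K0" "b < s"
    and le: "\<And>n c w. (\<And>\<xi>. \<xi> \<in> S n \<Longrightarrow> w \<xi> \<le> (\<Sum>j. avgE n \<xi> (levE (n + int j) (c (n + int j))))) \<Longrightarrow>
       Lp_enn M p (levE n w) \<le> ennreal K0 *
         (\<Sum>j. ennreal (2 powr (real j * b)) * Lp_enn M p (levE (n + int j) (c (n + int j))))"
    using Lp_enn_levE_le[OF s p] by blast
  obtain K where K: "0 \<le> K" and hardy:
    "\<And>A L. (\<And>n. A n \<le> ennreal K0 * (\<Sum>j. ennreal (2 powr (real j * b)) * L (n + int j))) \<Longrightarrow>
        lq_enn s q A \<le> ennreal K * lq_enn s q L"
    using lq_enn_hardy[OF q K0(2,1)] by blast
  show ?thesis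
  proof (rule that[OF K])
    fix c :: "int \<Rightarrow> 'z \<Rightarrow> ennreal" and w
    assume "\<And>n \<xi>. \<xi> \<in> S n \<Longrightarrow> w n \<xi> \<le> (\<Sum>j. avgE n \<xi> (levE (n + int j) (c (n + int j))))"
    then show "lq_enn s q (\<lambda>n. Lp_enn M p (levE n (w n))) \<le> ennreal K * lq_enn s q (\<lambda>n. Lp_enn M p (levE n (c n)))"
      by (intro hardy le)
  qed
qed

end

context filling_partition
begin

lemma AE_Tn_tendsto_Tr:
  assumes "0 < s" "0 < p" "0 < q" "I_mem S M s p q (dnorm S u)"
  shows "AE \<zeta> in M. (\<lambda>n::nat. Tn S \<psi> (int n) u \<zeta>) \<longlonglongrightarrow> Tr S \<psi> u \<zeta>"
  using AE_summable_lev_fun[OF assms] by eventually_elim (rule Tn_converges)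

lemma Tr_estimate:
  assumes s: "0 < s" and p: "ereal (Q / (Q + s)) < p" and q: "0 < q"
  obtains K :: real where "0 \<le> K"
    "\<And>u. I_mem S M s p q (dnorm S u) \<Longrightarrow>
       I_qnorm S M s p q (\<lambda>x. cmod (u x - Pavg M (Tr S \<psi> u) x)) \<le> ennreal K * I_qnorm S M s p q (dnorm S u)"
proof -
  have p0: "0 < p"
  proof -
    have "0 < ereal (Q / (Q + s))" using Q_pos s by simp
    then show ?thesis using p by order
  qed
  obtain K where K: "0 \<le> K" and le:
    "\<And>c w. (\<And>n \<xi>. \<xi> \<in> S n \<Longrightarrow> w n \<xi> \<le> (\<Sum>j. avgE n \<xi> (levE (n + int j) (c (n + int j))))) \<Longrightarrow>
       lq_enn s q (\<lambda>n. Lp_enn M p (levE n (w n))) \<le> ennreal K * lq_enn s q (\<lambda>n. Lp_enn M p (levE n (c n)))"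
    using lq_Lp_avgE_le[OF s p q] by blast
  have "I_qnorm S M s p q (\<lambda>x. cmod (u x - Pavg M (Tr S \<psi> u) x)) \<le> ennreal K * I_qnorm S M s p q (dnorm S u)"
    if I: "I_mem S M s p q (dnorm S u)" for u
  proof -
    define c where "c n \<xi> = ennreal (dnorm S u (n, \<xi>))" for n \<xi>
    \<comment> \<open>\<open>W\<close> will bound \<open>|u - P Tr u|\<close> at each vertex, but it
      is also an admissible \<open>w\<close> in \<open>le\<close>, with equality in the premise;
      this second role shows that \<open>W\<close> is finite.\<close>
    define W where "W n \<xi> = (\<Sum>j. avgE n \<xi> (levE (n + int j) (c (n + int j))))" for n \<xi>
    have Iu: "I_qnorm S M s p q (dnorm S u) = lq_enn s q (\<lambda>n. Lp_enn M p (levE n (c n)))"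
      by (simp add: I_qnorm_eq_lq_enn Lp_qnorm_lev_fun c_def[abs_def] dnorm_nonneg)
    have "lq_enn s q (\<lambda>n. Lp_enn M p (levE n (W n))) \<le> ennreal K * lq_enn s q (\<lambda>n. Lp_enn M p (levE n (c n)))"
      by (rule le) (simp add: W_def)
    also have "\<dots> < top"
      using I by (simp add: Iu[symmetric] I_mem_def ennreal_mult_less_top)
    finally have "Lp_enn M p (levE n (W n)) < top" for n
      using lq_enn_less_topD[OF q, of s "\<lambda>n. Lp_enn M p (levE n (W n))"] by blast
    then have W_fin: "W n \<xi> < top" if "\<xi> \<in> S n" for n \<xi>
      using that p0 by (intro less_top_of_Lp_enn_levE[of p n "W n"]) auto
    have diff: "avgE n \<xi> (\<lambda>\<zeta>. ennreal (cmod (u (n, \<xi>) - Tr S \<psi> u \<zeta>))) \<le> W n \<xi>" if \<xi>: "\<xi> \<in> S n" for n \<xi>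
    proof -
      have "avgE n \<xi> (\<lambda>\<zeta>. ennreal (cmod (u (n, \<xi>) - Tr S \<psi> u \<zeta>)))
         \<le> avgE n \<xi> (\<lambda>\<zeta>. \<Sum>j. levE (n + int j) (c (n + int j)) \<zeta>)"
      proof (rule avgE_mono_AE)
        show "AE \<zeta> in M. \<zeta> \<in> ball \<xi> (rad n) \<longrightarrow> ennreal (cmod (u (n, \<xi>) - Tr S \<psi> u \<zeta>))
            \<le> (\<Sum>j. levE (n + int j) (c (n + int j)) \<zeta>)"
          using AE_Tn_tendsto_Tr[OF s p0 q I]
        proof eventually_elim
          case (elim \<zeta>)
          show ?case
            using cmod_Tr_diff_le[OF elim, of \<xi> n] \<xi> by (simp add: active_def c_def[abs_def])
        qed
      qed
      also have "\<dots> = W n \<xi>" unfolding W_def by (rule avgE_suminf) measurable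
      finally show ?thesis .
    qed
    have est: "ennreal (cmod (u (n, \<xi>) - Pavg M (Tr S \<psi> u) (n, \<xi>))) \<le> W n \<xi>" if \<xi>: "\<xi> \<in> S n" for n \<xi>
    proof -
      let ?B = "ball \<xi> (rad n)"
      have const: "set_integrable M ?B (\<lambda>_. u (n, \<xi>))"
        using emeasure_ball_less_top[of \<xi> "rad n"]
        by (auto simp: set_integrable_def sets_M intro!: integrable_scaleR_left)
      \<comment> \<open>Finiteness of \<open>W\<close> makes the average of
        \<open>|u (n, \<xi>) - Tr u|\<close> finite. Constants are integrable on balls, so
        \<open>Tr u\<close> is too, and \<open>Pavg\<close> takes a true mean.\<close>
      have "set_integrable M ?B (\<lambda>\<zeta>. u (n, \<xi>) - Tr S \<psi> u \<zeta>)"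
        unfolding set_integrable_def
      proof (rule integrableI_bounded)
        have "(\<integral>\<^sup>+\<zeta>. ennreal (cmod (indicator ?B \<zeta> *\<^sub>R (u (n, \<xi>) - Tr S \<psi> u \<zeta>))) \<partial>M)
           = (\<integral>\<^sup>+\<zeta>. ennreal (cmod (u (n, \<xi>) - Tr S \<psi> u \<zeta>)) * indicator ?B \<zeta> \<partial>M)"
          by (intro nn_integral_cong) (auto split: split_indicator)
        also have "\<dots> = ennreal (measure M ?B) * avgE n \<xi> (\<lambda>\<zeta>. ennreal (cmod (u (n, \<xi>) - Tr S \<psi> u \<zeta>)))"
          by (rule avgE_measure[symmetric])
        also have "\<dots> \<le> ennreal (measure M ?B) * W n \<xi>"
          by (intro mult_left_mono diff \<xi>) auto
        also have "\<dots> < \<infinity>" using W_fin[OF \<xi>] by (simp add: ennreal_mult_less_top)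
        finally show "(\<integral>\<^sup>+\<zeta>. ennreal (cmod (indicator ?B \<zeta> *\<^sub>R (u (n, \<xi>) - Tr S \<psi> u \<zeta>))) \<partial>M) < \<infinity>" .
      qed measurable
      from set_integral_diff(1)[OF const this] have "set_integrable M ?B (Tr S \<psi> u)"
        by simp
      then show ?thesis
        by (rule order_trans[OF cmod_diff_Pavg_le diff[OF \<xi>]])
    qed
    have "I_qnorm S M s p q (\<lambda>x. cmod (u x - Pavg M (Tr S \<psi> u) x))
      = lq_enn s q (\<lambda>n. Lp_enn M p (levE n (\<lambda>\<xi>. ennreal (cmod (u (n, \<xi>) - Pavg M (Tr S \<psi> u) (n, \<xi>))))))"
      by (simp add: I_qnorm_eq_lq_enn Lp_qnorm_lev_fun)
    then show ?thesis
      unfolding Iu by (elim ssubst) (rule le, use est in \<open>simp add: W_def\<close>)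
  qed
  then show ?thesis using that K by blast
qed

lemma Tn_diff: "Tn S \<psi> n (\<lambda>x. u x - v x) \<zeta> = Tn S \<psi> n u \<zeta> - Tn S \<psi> n v \<zeta>"
  by (simp add: Tn_def left_diff_distrib sum_subtractf)

text \<open>\<open>u - P Tr u\<close> has finite quasi-norm, so its image under \<open>Tn\<close>
  tends to 0; linearity of \<open>Tn\<close> carries the limit over from \<open>u\<close> to
  \<open>P Tr u\<close>.\<close>

lemma Tn_Pavg_Tr_tendsto:
  assumes s: "0 < s" and p: "0 < p" and q: "0 < q" and I: "I_mem S M s p q (dnorm S u)"
    and I': "I_mem S M s p q (\<lambda>x. cmod (u x - Pavg M (Tr S \<psi> u) x))"
  shows "AE \<zeta> in M. (\<lambda>n::nat. Tn S \<psi> (int n) (Pavg M (Tr S \<psi> u)) \<zeta>) \<longlonglongrightarrow> Tr S \<psi> u \<zeta>"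
  using AE_Tn_tendsto_Tr[OF s p q I] Tn_tendsto_0[OF s p q I']
proof eventually_elim
  case (elim \<zeta>)
  from tendsto_diff[OF elim] show ?case by (simp add: Tn_diff)
qed

end

section \<open>Approximation of locally integrable functions\<close>

lemma tendsto_0_ennreal_le:
  fixes f g :: "nat \<Rightarrow> ennreal"
  assumes "g \<longlonglongrightarrow> 0" "\<And>n. f n \<le> g n"
  shows "f \<longlonglongrightarrow> 0"
  by (rule tendsto_sandwich[OF _ _ tendsto_const assms(1)]) (simp_all add: assms(2))

context filling_partition
begin

lemma loc_integrableD:
  assumes "loc_integrable M f"
  shows "f \<in> borel_measurable M" and "0 < r \<Longrightarrow> set_integrable M (ball \<xi> r) f"
  using assms by (auto simp: loc_integrable_def)

lemma loc_integrableI: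
  assumes [measurable]: "f \<in> borel_measurable M"
    and "\<And>\<xi> r. 0 < r \<Longrightarrow> (\<integral>\<^sup>+\<zeta>. indicator (ball \<xi> r) \<zeta> * ennreal (cmod (f \<zeta>)) \<partial>M) < top"
  shows "loc_integrable M f"
  unfolding loc_integrable_def set_integrable_def
proof (intro conjI allI impI integrableI_bounded)
  fix \<xi> :: 'a and r :: real assume "0 < r"
  have "(\<integral>\<^sup>+\<zeta>. ennreal (norm (indicator (ball \<xi> r) \<zeta> *\<^sub>R f \<zeta>)) \<partial>M)
      = (\<integral>\<^sup>+\<zeta>. indicator (ball \<xi> r) \<zeta> * ennreal (cmod (f \<zeta>)) \<partial>M)"
    by (intro nn_integral_cong) (auto split: split_indicator)
  then show "(\<integral>\<^sup>+\<zeta>. ennreal (norm (indicator (ball \<xi> r) \<zeta> *\<^sub>R f \<zeta>)) \<partial>M) < \<infinity>"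
    using assms(2)[OF \<open>0 < r\<close>, of \<xi>] by simp
qed measurable

lemma loc_integrable_bounded:
  assumes "f \<in> borel_measurable M" "\<And>\<zeta>. cmod (f \<zeta>) \<le> B"
  shows "loc_integrable M f"
proof (rule loc_integrableI[OF assms(1)])
  fix \<xi> :: 'a and r :: real
  have "(\<integral>\<^sup>+\<zeta>. indicator (ball \<xi> r) \<zeta> * ennreal (cmod (f \<zeta>)) \<partial>M)
      \<le> (\<integral>\<^sup>+\<zeta>. ennreal B * indicator (ball \<xi> r) \<zeta> \<partial>M)"
    using assms(2) by (intro nn_integral_mono) (auto intro: ennreal_leI split: split_indicator)
  also have "\<dots> = ennreal B * emeasure M (ball \<xi> r)"
    by (rule nn_integral_cmult_indicator) (simp add: sets_M)
  also have "\<dots> < top" using emeasure_ball_less_top by (simp add: ennreal_mult_less_top)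
  finally show "(\<integral>\<^sup>+\<zeta>. indicator (ball \<xi> r) \<zeta> * ennreal (cmod (f \<zeta>)) \<partial>M) < top" .
qed

lemma Pavg_add:
  assumes "loc_integrable M f" "loc_integrable M g"
  shows "Pavg M (\<lambda>\<zeta>. f \<zeta> + g \<zeta>) x = Pavg M f x + Pavg M g x"
  using assms by (simp add: Pavg_def Bx_def set_integral_add loc_integrableD add_divide_distrib)

lemma Pavg_cmult: "Pavg M (\<lambda>\<zeta>. c * f \<zeta>) x = c * Pavg M f x"
  by (simp add: Pavg_def)

lemma Tn_add: "Tn S \<psi> n (\<lambda>x. u x + v x) \<zeta> = Tn S \<psi> n u \<zeta> + Tn S \<psi> n v \<zeta>"
  by (simp add: Tn_def distrib_right sum.distrib)

lemma Tn_cmult: "Tn S \<psi> n (\<lambda>x. c * u x) \<zeta> = c * Tn S \<psi> n u \<zeta>"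
  by (simp add: Tn_def sum_distrib_left mult_ac)

lemma loc_integrable_add:
  assumes f: "loc_integrable M f" and g: "loc_integrable M g"
  shows "loc_integrable M (\<lambda>\<zeta>. f \<zeta> + g \<zeta>)"
  using assms by (auto simp: loc_integrable_def)

lemma loc_integrable_cmult:
  assumes f: "loc_integrable M f"
  shows "loc_integrable M (\<lambda>\<zeta>. c * f \<zeta>)"
  using assms by (auto simp: loc_integrable_def)

definition L1_error :: "('a \<Rightarrow> complex) \<Rightarrow> 'a \<Rightarrow> real \<Rightarrow> nat \<Rightarrow> ennreal" where
  "L1_error f \<xi> r n =
    (\<integral>\<^sup>+\<zeta>. indicator (ball \<xi> r) \<zeta> * ennreal (cmod (Tn S \<psi> (int n) (Pavg M f) \<zeta> - f \<zeta>)) \<partial>M)"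

text \<open>The class for which the local convergence holds. It is shown to be linear and closed
  under suitable limits, to contain the locally integrable Lipschitz functions, and in the end to
  contain every locally integrable function.\<close>

definition L1_approx :: "('a \<Rightarrow> complex) \<Rightarrow> bool" where
  "L1_approx f \<longleftrightarrow> loc_integrable M f \<and> (\<forall>\<xi> r. 0 < r \<longrightarrow> L1_error f \<xi> r \<longlonglongrightarrow> 0)"

lemma cmod_Tn_Pavg_le:
  assumes h: "loc_integrable M h"
  shows "ennreal (cmod (Tn S \<psi> n (Pavg M h) \<zeta>)) \<le> levE n (\<lambda>\<xi>. avgE n \<xi> (\<lambda>\<zeta>. ennreal (cmod (h \<zeta>)))) \<zeta>"
proof -
  have "ennreal (cmod (Tn S \<psi> n (Pavg M h) \<zeta>)) \<le> ennreal (lev_fun S (\<lambda>x. cmod (Pavg M h x)) n \<zeta>)"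
    by (intro ennreal_leI cmod_Tn_le_lev_fun)
  also have "\<dots> \<le> levE n (\<lambda>\<xi>. avgE n \<xi> (\<lambda>\<zeta>. ennreal (cmod (h \<zeta>)))) \<zeta>"
    unfolding ennreal_lev_fun levE_def
    using cmod_diff_Pavg_le[of _ n h 0] loc_integrableD(2)[OF h, of "rad n"]
    by (intro sum_mono) simp
  finally show ?thesis .
qed

text \<open>The bound uniform in \<open>n\<close>: averages over boundedly overlapping balls. Levels
  are non-negative, so radii are at most 1, and two radii starting in
  \<open>ball \<xi>\<^sub>0 r\<close> stay within \<open>r + 2\<close>.\<close>

lemma nn_integral_Tn_Pavg_le:
  assumes h: "loc_integrable M h"
  shows "(\<integral>\<^sup>+\<zeta>. indicator (ball \<xi>\<^sub>0 r) \<zeta> * ennreal (cmod (Tn S \<psi> (int n) (Pavg M h) \<zeta>)) \<partial>M)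
    \<le> ennreal (cnt 3) * (\<integral>\<^sup>+\<zeta>. indicator (ball \<xi>\<^sub>0 (r + 2)) \<zeta> * ennreal (cmod (h \<zeta>)) \<partial>M)"
proof -
  have [measurable]: "h \<in> borel_measurable M" using h by (rule loc_integrableD)
  let ?n = "int n"
  define H where "H \<zeta> = indicator (ball \<xi>\<^sub>0 (r + 2)) \<zeta> * ennreal (cmod (h \<zeta>))" for \<zeta>
  have [measurable]: "H \<in> borel_measurable M" unfolding H_def by measurable
  have rad1: "rad ?n \<le> 1" using powr_mono[of "- real n" 0 "2::real"] by simp
  have "(\<integral>\<^sup>+\<zeta>. indicator (ball \<xi>\<^sub>0 r) \<zeta> * ennreal (cmod (Tn S \<psi> ?n (Pavg M h) \<zeta>)) \<partial>M)
      \<le> (\<integral>\<^sup>+\<zeta>. levE ?n (\<lambda>\<xi>. avgE ?n \<xi> H) \<zeta> \<partial>M)"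
  proof (rule nn_integral_mono)
    fix \<zeta>
    show "indicator (ball \<xi>\<^sub>0 r) \<zeta> * ennreal (cmod (Tn S \<psi> ?n (Pavg M h) \<zeta>)) \<le> levE ?n (\<lambda>\<xi>. avgE ?n \<xi> H) \<zeta>"
    proof (cases "\<zeta> \<in> ball \<xi>\<^sub>0 r")
      case True
      have "levE ?n (\<lambda>\<xi>. avgE ?n \<xi> (\<lambda>\<zeta>. ennreal (cmod (h \<zeta>)))) \<zeta> \<le> levE ?n (\<lambda>\<xi>. avgE ?n \<xi> H) \<zeta>"
        unfolding levE_def
      proof (intro sum_mono avgE_mono_AE AE_I2 impI)
        fix \<xi> \<eta> assume "\<xi> \<in> active S ?n \<zeta>" "\<eta> \<in> ball \<xi> (rad ?n)"
        then have "dist \<xi> \<zeta> < 1" "dist \<xi> \<eta> < 1" using rad1 by (auto simp: active_def)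
        then have "dist \<xi>\<^sub>0 \<eta> < r + 2"
          using True dist_triangle[of \<xi>\<^sub>0 \<eta> \<zeta>] dist_triangle3[of \<zeta> \<eta> \<xi>] by simp
        then show "ennreal (cmod (h \<eta>)) \<le> H \<eta>" by (simp add: H_def)
      qed
      from order_trans[OF cmod_Tn_Pavg_le[OF h] this] show ?thesis
        unfolding indicator_simps(1)[OF True] mult_1 .
    qed simp
  qed
  also have "\<dots> = (\<integral>\<^sup>+\<xi>. (\<integral>\<^sup>+\<zeta>. H \<zeta> * indicator (ball \<xi> (rad ?n)) \<zeta> \<partial>M) \<partial>count_space (S ?n))"
    unfolding nn_integral_levE emeasure_ball mult.commute[of "avgE _ _ _"] avgE_measure ..
  also have "\<dots> \<le> (\<integral>\<^sup>+\<xi>. (\<integral>\<^sup>+\<zeta>. H \<zeta> * indicator (ball \<xi> (3 * rad ?n)) \<zeta> \<partial>M) \<partial>count_space (S ?n))"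
  proof (intro nn_integral_mono mult_left_mono)
    fix \<xi> \<zeta>
    have "rad ?n \<le> 3 * rad ?n" by simp
    then have "ball \<xi> (rad ?n) \<subseteq> ball \<xi> (3 * rad ?n)" by (rule subset_ball)
    then show "indicator (ball \<xi> (rad ?n)) \<zeta> \<le> (indicator (ball \<xi> (3 * rad ?n)) \<zeta> :: ennreal)"
      by (auto split: split_indicator)
  qed auto
  also have "\<dots> \<le> ennreal (cnt 3) * (\<integral>\<^sup>+\<zeta>. H \<zeta> \<partial>M)"
    by (rule nn_integral_overlap_le) measurable
  finally show ?thesis by (simp add: H_def)
qed

section \<open>Closure properties of the class of approximated functions\<close>

lemma L1_error_add_le:
  assumes f: "loc_integrable M f" and g: "loc_integrable M g"
  shows "L1_error (\<lambda>\<zeta>. f \<zeta> + g \<zeta>) \<xi> r n \<le> L1_error f \<xi> r n + L1_error g \<xi> r n"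
proof -
  have [measurable]: "f \<in> borel_measurable M" "g \<in> borel_measurable M"
    using assms by (auto intro: loc_integrableD)
  have "L1_error (\<lambda>\<zeta>. f \<zeta> + g \<zeta>) \<xi> r n
     \<le> (\<integral>\<^sup>+\<zeta>. indicator (ball \<xi> r) \<zeta> * ennreal (cmod (Tn S \<psi> (int n) (Pavg M f) \<zeta> - f \<zeta>))
        + indicator (ball \<xi> r) \<zeta> * ennreal (cmod (Tn S \<psi> (int n) (Pavg M g) \<zeta> - g \<zeta>)) \<partial>M)"
    unfolding L1_error_def Pavg_add[OF f g, abs_def] Tn_add distrib_left[symmetric]
    by (intro nn_integral_mono mult_left_mono)
      (auto simp: ennreal_plus[symmetric] add_diff_add norm_triangle_ineq intro!: ennreal_leI simp del: ennreal_plus)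
  also have "\<dots> = L1_error f \<xi> r n + L1_error g \<xi> r n"
    unfolding L1_error_def by (rule nn_integral_add) measurable
  finally show ?thesis .
qed

lemma L1_error_cmult: 
  assumes f: "loc_integrable M f"
  shows "L1_error (\<lambda>\<zeta>. c * f \<zeta>) \<xi> r n = ennreal (cmod c) * L1_error f \<xi> r n"
proof -
  have [measurable]: "f \<in> borel_measurable M"
    using assms by (auto intro: loc_integrableD)
  have "L1_error (\<lambda>\<zeta>. c * f \<zeta>) \<xi> r n = (\<integral>\<^sup>+\<zeta>. ennreal (cmod c) *
      (indicator (ball \<xi> r) \<zeta> * ennreal (cmod (Tn S \<psi> (int n) (Pavg M f) \<zeta> - f \<zeta>))) \<partial>M)"
    unfolding L1_error_def Pavg_cmult[abs_def] Tn_cmult right_diff_distrib[symmetric] norm_mult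
    by (intro nn_integral_cong) (simp add: ennreal_mult mult_ac)
  also have "\<dots> = ennreal (cmod c) * L1_error f \<xi> r n"
    unfolding L1_error_def by (rule nn_integral_cmult) measurable
  finally show ?thesis .
qed

lemma L1_error_le:
  assumes f: "loc_integrable M f"
  shows "L1_error f \<xi> r n
    \<le> ennreal (cnt 3 + 1) * (\<integral>\<^sup>+\<zeta>. indicator (ball \<xi> (r + 2)) \<zeta> * ennreal (cmod (f \<zeta>)) \<partial>M)"
proof -
  have [measurable]: "f \<in> borel_measurable M"
    using assms by (auto intro: loc_integrableD)
  let ?I = "\<integral>\<^sup>+\<zeta>. indicator (ball \<xi> (r + 2)) \<zeta> * ennreal (cmod (f \<zeta>)) \<partial>M"
  have "L1_error f \<xi> r n \<le> (\<integral>\<^sup>+\<zeta>. indicator (ball \<xi> r) \<zeta> * ennreal (cmod (Tn S \<psi> (int n) (Pavg M f) \<zeta>))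
        + indicator (ball \<xi> r) \<zeta> * ennreal (cmod (f \<zeta>)) \<partial>M)"
    unfolding L1_error_def distrib_left[symmetric]
    by (intro nn_integral_mono mult_left_mono)
      (auto simp: ennreal_plus[symmetric] norm_triangle_ineq4 intro!: ennreal_leI simp del: ennreal_plus)
  also have "\<dots> = (\<integral>\<^sup>+\<zeta>. indicator (ball \<xi> r) \<zeta> * ennreal (cmod (Tn S \<psi> (int n) (Pavg M f) \<zeta>)) \<partial>M)
        + (\<integral>\<^sup>+\<zeta>. indicator (ball \<xi> r) \<zeta> * ennreal (cmod (f \<zeta>)) \<partial>M)"
    by (rule nn_integral_add) measurable
  also have "\<dots> \<le> ennreal (cnt 3) * ?I + ?I"
    by (intro add_mono nn_integral_Tn_Pavg_le f nn_integral_mono mult_right_mono)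
      (auto split: split_indicator)
  also have "\<dots> = ennreal (cnt 3 + 1) * ?I"
    using cnt_nonneg[of 3] by (simp add: distrib_right)
  finally show ?thesis .
qed

lemma L1_approx_add:
  assumes "L1_approx f" "L1_approx g"
  shows "L1_approx (\<lambda>\<zeta>. f \<zeta> + g \<zeta>)"
  unfolding L1_approx_def
proof (intro conjI allI impI)
  have li: "loc_integrable M f" "loc_integrable M g" using assms by (auto simp: L1_approx_def)
  then show "loc_integrable M (\<lambda>\<zeta>. f \<zeta> + g \<zeta>)" by (rule loc_integrable_add)
  fix \<xi> :: 'a and r :: real assume "0 < r"
  then have "(\<lambda>n. L1_error f \<xi> r n + L1_error g \<xi> r n) \<longlonglongrightarrow> 0 + 0"
    using assms by (intro tendsto_add) (auto simp: L1_approx_def)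
  then have "(\<lambda>n. L1_error f \<xi> r n + L1_error g \<xi> r n) \<longlonglongrightarrow> 0" by simp
  from tendsto_0_ennreal_le[OF this L1_error_add_le[OF li]]
  show "L1_error (\<lambda>\<zeta>. f \<zeta> + g \<zeta>) \<xi> r \<longlonglongrightarrow> 0" .
qed

lemma L1_approx_cmult:
  assumes "L1_approx f"
  shows "L1_approx (\<lambda>\<zeta>. c * f \<zeta>)"
  unfolding L1_approx_def
proof (intro conjI allI impI)
  have li: "loc_integrable M f" using assms by (auto simp: L1_approx_def)
  then show "loc_integrable M (\<lambda>\<zeta>. c * f \<zeta>)" by (rule loc_integrable_cmult)
  fix \<xi> :: 'a and r :: real assume "0 < r"
  then have "(\<lambda>n. ennreal (cmod c) * L1_error f \<xi> r n) \<longlonglongrightarrow> ennreal (cmod c) * 0"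
    using assms by (intro ennreal_tendsto_cmult) (auto simp: L1_approx_def)
  then show "L1_error (\<lambda>\<zeta>. c * f \<zeta>) \<xi> r \<longlonglongrightarrow> 0"
    by (simp add: L1_error_cmult[OF li, abs_def] ext[OF L1_error_cmult[OF li]])
qed

text \<open>The error of \<open>f - h\<close> is at most \<open>K\<close> times its integral over
  the ball enlarged by 2, uniformly in the level. So \<open>h\<close> may depend on the ball and on
  \<open>e\<close>; it is taken within \<open>e / (2 * K)\<close>, which leaves \<open>e / 2\<close>
  for its own error.\<close>

lemma L1_approx_limit:
  assumes f: "loc_integrable M f"
    and h: "\<And>\<xi> r e. 0 < r \<Longrightarrow> 0 < e \<Longrightarrow> \<exists>h. L1_approx h \<and>
      (\<integral>\<^sup>+\<zeta>. indicator (ball \<xi> r) \<zeta> * ennreal (cmod (f \<zeta> - h \<zeta>)) \<partial>M) < ennreal e"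
  shows "L1_approx f"
  unfolding L1_approx_def
proof (intro conjI allI impI f tendsto_zero_ennreal)
  fix \<xi> :: 'a and r e :: real assume r: "0 < r" and e: "0 < e"
  define K where "K = cnt 3 + 1"
  have K: "0 < K" using cnt_nonneg[of 3] by (simp add: K_def)
  obtain h where h: "L1_approx h"
    and le: "(\<integral>\<^sup>+\<zeta>. indicator (ball \<xi> (r + 2)) \<zeta> * ennreal (cmod (f \<zeta> - h \<zeta>)) \<partial>M) < ennreal (e / (2 * K))"
    using h[of "r + 2" "e / (2 * K)" \<xi>] r e K by auto
  define d where "d \<zeta> = f \<zeta> + (- 1) * h \<zeta>" for \<zeta>
  have hl: "loc_integrable M h" using h by (simp add: L1_approx_def)
  have dl: "loc_integrable M d"
    unfolding d_def by (intro loc_integrable_add f loc_integrable_cmult hl)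
  have d_bound: "L1_error d \<xi> r n \<le> ennreal (e / 2)" for n
  proof -
    have "L1_error d \<xi> r n \<le> ennreal K * (\<integral>\<^sup>+\<zeta>. indicator (ball \<xi> (r + 2)) \<zeta> * ennreal (cmod (d \<zeta>)) \<partial>M)"
      unfolding K_def by (rule L1_error_le[OF dl])
    also have "\<dots> \<le> ennreal K * ennreal (e / (2 * K))"
      using le by (intro mult_left_mono) (auto simp: d_def)
    also have "\<dots> = ennreal (e / 2)" using K e by (simp add: ennreal_mult[symmetric])
    finally show ?thesis .
  qed
  have "L1_error h \<xi> r \<longlonglongrightarrow> 0" using h r by (simp add: L1_approx_def)
  then have "\<forall>\<^sub>F n in sequentially. L1_error h \<xi> r n < ennreal (e / 2)"
    by (rule order_tendstoD) (use e in simp)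
  then show "\<forall>\<^sub>F n in sequentially. L1_error f \<xi> r n < ennreal e"
  proof eventually_elim
    case (elim n)
    have "f = (\<lambda>\<zeta>. d \<zeta> + h \<zeta>)" by (simp add: d_def)
    then have "L1_error f \<xi> r n \<le> L1_error d \<xi> r n + L1_error h \<xi> r n"
      using L1_error_add_le[OF dl hl, of \<xi> r n] by simp
    also have "\<dots> \<le> ennreal (e / 2) + L1_error h \<xi> r n"
      by (intro add_right_mono d_bound)
    also have "\<dots> < ennreal (e / 2) + ennreal (e / 2)"
      using elim by (simp add: ennreal_add_left_cancel_less)
    also have "\<dots> = ennreal e" using e by (simp add: ennreal_plus[symmetric] del: ennreal_plus)
    finally show ?case .
  qed
qed

text \<open>Dominated convergence on each ball brings \<open>h m\<close> close to \<open>f\<close>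
  there, as \<open>L1_approx_limit\<close> asks. A majorant integrable over balls suffices, so
  uniformly bounded sequences are covered.\<close>

lemma L1_approx_dominated:
  assumes h: "\<And>m. L1_approx (h m)" and [measurable]: "f \<in> borel_measurable M"
    and lim: "\<And>\<zeta>. (\<lambda>m. h m \<zeta>) \<longlonglongrightarrow> f \<zeta>"
    and dom: "\<And>m \<zeta>. cmod (h m \<zeta>) \<le> w \<zeta>"
    and w[measurable]: "w \<in> borel_measurable M"
    and w_int: "\<And>\<xi> r. 0 < r \<Longrightarrow> (\<integral>\<^sup>+\<zeta>. indicator (ball \<xi> r) \<zeta> * ennreal (w \<zeta>) \<partial>M) < top"
  shows "L1_approx f"
proof (rule L1_approx_limit)
  have [measurable]: "h m \<in> borel_measurable M" for m
    using h[of m] by (auto simp: L1_approx_def intro: loc_integrableD)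
  have f_le: "cmod (f \<zeta>) \<le> w \<zeta>" for \<zeta>
    by (rule LIMSEQ_le_const2[OF tendsto_norm[OF lim]]) (use dom in auto)
  show "loc_integrable M f"
  proof (rule loc_integrableI)
    fix \<xi> :: 'a and r :: real assume "0 < r"
    have "(\<integral>\<^sup>+\<zeta>. indicator (ball \<xi> r) \<zeta> * ennreal (cmod (f \<zeta>)) \<partial>M)
        \<le> (\<integral>\<^sup>+\<zeta>. indicator (ball \<xi> r) \<zeta> * ennreal (w \<zeta>) \<partial>M)"
      by (intro nn_integral_mono mult_left_mono ennreal_leI f_le) auto
    then show "(\<integral>\<^sup>+\<zeta>. indicator (ball \<xi> r) \<zeta> * ennreal (cmod (f \<zeta>)) \<partial>M) < top"
      using w_int[OF \<open>0 < r\<close>, of \<xi>] by (rule le_less_trans)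
  qed measurable
  fix \<xi> :: 'a and r e :: real assume r: "0 < r" and e: "0 < e"
  have w0: "0 \<le> w \<zeta>" for \<zeta> using f_le[of \<zeta>] norm_ge_zero[of "f \<zeta>"] by linarith
  have "(\<lambda>m. \<integral>\<^sup>+\<zeta>. indicator (ball \<xi> r) \<zeta> * ennreal (cmod (f \<zeta> - h m \<zeta>)) \<partial>M)
      \<longlonglongrightarrow> (\<integral>\<^sup>+\<zeta>. 0 \<partial>M)"
  proof (rule nn_integral_dominated_convergence[where w = "\<lambda>\<zeta>. 2 * (indicator (ball \<xi> r) \<zeta> * ennreal (w \<zeta>))"])
    show "AE \<zeta> in M. indicator (ball \<xi> r) \<zeta> * ennreal (cmod (f \<zeta> - h m \<zeta>))
        \<le> 2 * (indicator (ball \<xi> r) \<zeta> * ennreal (w \<zeta>))" for m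
    proof (rule AE_I2)
      fix \<zeta>
      have "cmod (f \<zeta> - h m \<zeta>) \<le> 2 * w \<zeta>"
        using norm_triangle_ineq4[of "f \<zeta>" "h m \<zeta>"] f_le[of \<zeta>] dom[of m \<zeta>] by linarith
      then have "ennreal (cmod (f \<zeta> - h m \<zeta>)) \<le> ennreal (2 * w \<zeta>)" by (rule ennreal_leI)
      also have "\<dots> = 2 * ennreal (w \<zeta>)" using w0 by (simp add: ennreal_mult)
      finally show "indicator (ball \<xi> r) \<zeta> * ennreal (cmod (f \<zeta> - h m \<zeta>))
        \<le> 2 * (indicator (ball \<xi> r) \<zeta> * ennreal (w \<zeta>))"
        by (auto split: split_indicator)
    qed
    show "(\<integral>\<^sup>+\<zeta>. 2 * (indicator (ball \<xi> r) \<zeta> * ennreal (w \<zeta>)) \<partial>M) < \<infinity>"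
      using w_int[OF r, of \<xi>] by (simp add: nn_integral_cmult ennreal_mult_less_top)
    show "AE \<zeta> in M. (\<lambda>m. indicator (ball \<xi> r) \<zeta> * ennreal (cmod (f \<zeta> - h m \<zeta>))) \<longlonglongrightarrow> 0"
    proof (rule AE_I2)
      fix \<zeta>
      have "(\<lambda>m. ennreal (cmod (f \<zeta> - h m \<zeta>))) \<longlonglongrightarrow> ennreal (cmod (f \<zeta> - f \<zeta>))"
        by (intro tendsto_intros lim)
      then show "(\<lambda>m. indicator (ball \<xi> r) \<zeta> * ennreal (cmod (f \<zeta> - h m \<zeta>))) \<longlonglongrightarrow> 0"
        by (auto split: split_indicator)
    qed
  qed measurable
  then have "\<forall>\<^sub>F m in sequentially. (\<integral>\<^sup>+\<zeta>. indicator (ball \<xi> r) \<zeta> * ennreal (cmod (f \<zeta> - h m \<zeta>)) \<partial>M) < ennreal e"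
    by (intro order_tendstoD) (use e in auto)
  then obtain m where "(\<integral>\<^sup>+\<zeta>. indicator (ball \<xi> r) \<zeta> * ennreal (cmod (f \<zeta> - h m \<zeta>)) \<partial>M) < ennreal e"
    unfolding eventually_sequentially by blast
  then show "\<exists>h. L1_approx h \<and>
      (\<integral>\<^sup>+\<zeta>. indicator (ball \<xi> r) \<zeta> * ennreal (cmod (f \<zeta> - h \<zeta>)) \<partial>M) < ennreal e"
    using h by blast
qed

text \<open>Every point of an active ball at \<open>\<zeta>\<close> is within
  \<open>2 * rad n\<close> of \<open>\<zeta>\<close>, so the averages, and their convex
  combinations, differ from \<open>f \<zeta>\<close> by at most
  \<open>|L| * (2 * rad n)\<close>.\<close>

lemma L1_approx_lipschitz:
  fixes f :: "'a \<Rightarrow> complex"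
  assumes f: "loc_integrable M f" and L: "\<And>x y. cmod (f x - f y) \<le> L * dist x y"
  shows "L1_approx f"
  unfolding L1_approx_def
proof (intro conjI allI impI f)
  fix \<xi>\<^sub>0 :: 'a and r :: real assume r: "0 < r"
  have bound: "cmod (Tn S \<psi> n (Pavg M f) \<zeta> - f \<zeta>) \<le> \<bar>L\<bar> * (2 * rad n)" for n \<zeta>
  proof (rule cmod_Tn_minus_const_le)
    fix \<xi> assume \<xi>: "\<xi> \<in> active S n \<zeta>"
    have "ennreal (cmod (f \<zeta> - Pavg M f (n, \<xi>))) \<le> avgE n \<xi> (\<lambda>\<eta>. ennreal (cmod (f \<zeta> - f \<eta>)))"
      by (intro cmod_diff_Pavg_le loc_integrableD(2)[OF f]) simp
    also have "\<dots> \<le> avgE n \<xi> (\<lambda>\<eta>. ennreal (\<bar>L\<bar> * (2 * rad n)))"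
    proof (intro avgE_mono_AE AE_I2 impI ennreal_leI)
      fix \<eta> assume "\<eta> \<in> ball \<xi> (rad n)"
      then have "dist \<zeta> \<eta> \<le> 2 * rad n"
        using \<xi> dist_triangle3[of \<zeta> \<eta> \<xi>] by (simp add: active_def)
      then have "\<bar>L\<bar> * dist \<zeta> \<eta> \<le> \<bar>L\<bar> * (2 * rad n)" by (intro mult_left_mono) auto
      moreover have "L * dist \<zeta> \<eta> \<le> \<bar>L\<bar> * dist \<zeta> \<eta>" by (intro mult_right_mono) auto
      ultimately show "cmod (f \<zeta> - f \<eta>) \<le> \<bar>L\<bar> * (2 * rad n)" using L[of \<zeta> \<eta>] by linarith
    qed
    also have "\<dots> \<le> ennreal (\<bar>L\<bar> * (2 * rad n))" by (rule avgE_le_ess_bound) simp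
    finally show "cmod (Pavg M f (n, \<xi>) - f \<zeta>) \<le> \<bar>L\<bar> * (2 * rad n)"
      by (subst (asm) ennreal_le_iff) (simp_all add: norm_minus_commute)
  qed
  define m where "m = measure M (ball \<xi>\<^sub>0 r)"
  have "(\<lambda>n. rad (int n)) = (\<lambda>n. (1 / 2) ^ n)"
    by (simp add: powr_minus_divide powr_realpow power_one_over)
  moreover have "(\<lambda>n. (1 / 2 :: real) ^ n) \<longlonglongrightarrow> 0" by (rule LIMSEQ_power_zero) simp
  ultimately have "(\<lambda>n. rad (int n)) \<longlonglongrightarrow> 0" by (simp only:)
  then have "(\<lambda>n. ennreal (\<bar>L\<bar> * (2 * rad (int n)) * m)) \<longlonglongrightarrow> ennreal (\<bar>L\<bar> * (2 * 0) * m)"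
    by (intro tendsto_intros)
  then have lim: "(\<lambda>n. ennreal (\<bar>L\<bar> * (2 * rad (int n)) * m)) \<longlonglongrightarrow> 0" by (simp only: mult_zero_right mult_zero_left ennreal_0)
  have "L1_error f \<xi>\<^sub>0 r n \<le> ennreal (\<bar>L\<bar> * (2 * rad (int n)) * m)" for n
  proof -
    have "L1_error f \<xi>\<^sub>0 r n \<le> (\<integral>\<^sup>+\<zeta>. ennreal (\<bar>L\<bar> * (2 * rad (int n))) * indicator (ball \<xi>\<^sub>0 r) \<zeta> \<partial>M)"
      unfolding L1_error_def
    proof (rule nn_integral_mono)
      fix \<zeta>
      show "indicator (ball \<xi>\<^sub>0 r) \<zeta> * ennreal (cmod (Tn S \<psi> (int n) (Pavg M f) \<zeta> - f \<zeta>))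
          \<le> ennreal (\<bar>L\<bar> * (2 * rad (int n))) * indicator (ball \<xi>\<^sub>0 r) \<zeta>"
        using ennreal_leI[OF bound[of "int n" \<zeta>]] by (cases "\<zeta> \<in> ball \<xi>\<^sub>0 r") simp_all
    qed
    also have "\<dots> = ennreal (\<bar>L\<bar> * (2 * rad (int n))) * emeasure M (ball \<xi>\<^sub>0 r)"
      by (rule nn_integral_cmult_indicator) (simp add: sets_M)
    also have "\<dots> = ennreal (\<bar>L\<bar> * (2 * rad (int n)) * m)"
      unfolding emeasure_ball m_def by (rule ennreal_mult[symmetric]) auto
    finally show ?thesis .
  qed
  with lim show "L1_error f \<xi>\<^sub>0 r \<longlonglongrightarrow> 0"
    by (rule tendsto_0_ennreal_le)
qed

lemma nn_integral_ball_const_less_top: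
  "(\<integral>\<^sup>+\<zeta>. indicator (ball \<xi> r) \<zeta> * ennreal B \<partial>M) < top"
proof -
  have "(\<integral>\<^sup>+\<zeta>. indicator (ball \<xi> r) \<zeta> * ennreal B \<partial>M) = ennreal B * emeasure M (ball \<xi> r)"
    unfolding mult.commute[of _ "ennreal B"] by (rule nn_integral_cmult_indicator) (simp add: sets_M)
  then show ?thesis
    using emeasure_ball_less_top[of \<xi> r] by (simp add: ennreal_mult_less_top)
qed

lemma L1_approx_const: "L1_approx (\<lambda>_. a)"
  by (rule L1_approx_lipschitz[where L = 0]) (auto intro: loc_integrable_bounded)

lemma L1_approx_indicator_open:
  assumes "open U"
  shows "L1_approx (\<lambda>\<zeta>. indicator U \<zeta>)"
\<comment> \<open>\<open>infdist\<close> to the empty set is 0 by convention, so for the whole space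
  the functions \<open>h m\<close> below would vanish instead of tending to 1.\<close>
proof (cases "- U = {}")
  case True
  then have "U = UNIV" by blast
  then show ?thesis by (simp add: L1_approx_const)
next
  case False
  define h where "h m \<zeta> = complex_of_real (min 1 (real m * infdist \<zeta> (- U)))" for m :: nat and \<zeta> :: 'a
  have [measurable]: "(\<lambda>\<zeta>. infdist \<zeta> (- U)) \<in> borel_measurable M"
    by (simp add: measurable_cong_sets[OF sets_M refl] borel_measurable_continuous_onI continuous_on_infdist continuous_on_id)
  have le1: "cmod (h m \<zeta>) \<le> 1" for m \<zeta>
    by (simp add: h_def infdist_nonneg min_def abs_mult)
  show ?thesis
  proof (rule L1_approx_dominated[where h = h and w = "\<lambda>_. 1"])
    fix m
    show "L1_approx (h m)"
    proof (rule L1_approx_lipschitz)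
      have "h m \<in> borel_measurable M" unfolding h_def by measurable
      then show "loc_integrable M (h m)" using le1 by (rule loc_integrable_bounded)
      fix x y
      have "\<bar>infdist x (- U) - infdist y (- U)\<bar> \<le> dist x y"
        using infdist_triangle[of x "- U" y] infdist_triangle[of y "- U" x] by (simp add: dist_commute)
      then have "\<bar>real m * infdist x (- U) - real m * infdist y (- U)\<bar> \<le> real m * dist x y"
        by (simp add: right_diff_distrib[symmetric] abs_mult mult_left_mono)
      then have "\<bar>min 1 (real m * infdist x (- U)) - min 1 (real m * infdist y (- U))\<bar> \<le> real m * dist x y"
        by (auto simp: min_def abs_if split: if_splits)
      then show "cmod (h m x - h m y) \<le> real m * dist x y"
        unfolding h_def of_real_diff[symmetric] norm_of_real .
    qed
    show "(\<integral>\<^sup>+\<zeta>. indicator (ball \<xi> r) \<zeta> * ennreal 1 \<partial>M) < top" for \<xi> r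
      by (rule nn_integral_ball_const_less_top)
  next
    fix \<zeta>
    show "(\<lambda>m. h m \<zeta>) \<longlonglongrightarrow> indicator U \<zeta>"
    proof (cases "\<zeta> \<in> U")
      case True
      then have pos: "0 < infdist \<zeta> (- U)"
        using assms False in_closed_iff_infdist_zero[of "- U" \<zeta>] infdist_nonneg[of \<zeta> "- U"]
        by (auto simp: closed_def less_le)
      obtain N :: nat where N: "1 / infdist \<zeta> (- U) \<le> real N" using real_arch_simple by blast
      have "h m \<zeta> = 1" if "N \<le> m" for m
      proof -
        have "1 / infdist \<zeta> (- U) \<le> real m" using N that by linarith
        then have "1 \<le> real m * infdist \<zeta> (- U)" using pos by (simp add: pos_divide_le_eq)
        then show ?thesis by (simp add: h_def)
      qed
      then have "(\<lambda>m. h m \<zeta>) \<longlonglongrightarrow> 1"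
        by (intro tendsto_eventually) (auto simp: eventually_sequentially)
      then show ?thesis using True by simp
    next
      case nin: False
      then have "infdist \<zeta> (- U) = 0" by simp
      then show ?thesis using nin by (simp add: h_def)
    qed
    show "cmod (h m \<zeta>) \<le> 1" for m by (rule le1)
  next
    show "(\<lambda>\<zeta>. indicator U \<zeta> :: complex) \<in> borel_measurable M"
      using assms by (intro borel_measurable_indicator) (simp add: sets_M)
  qed simp
qed

text \<open>The sets whose indicators are approximated form a Dynkin system: complements by
  linearity, disjoint unions by dominated convergence. It contains the open sets, which are stable
  under intersection and generate the Borel sets.\<close>

lemma L1_approx_indicator:
  assumes "A \<in> sets borel"
  shows "L1_approx (\<lambda>\<zeta>. indicator A \<zeta>)"
proof -
  have "Int_stable {U::'a set. open U}" by (auto simp: Int_stable_def)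
  moreover have "{U::'a set. open U} \<subseteq> Pow UNIV" by simp
  moreover have "A \<in> sigma_sets UNIV {U::'a set. open U}"
    using assms by (simp add: borel_def)
  ultimately show ?thesis
  proof (induction rule: sigma_sets_induct_disjoint)
    case (basic U)
    then show ?case by (auto intro: L1_approx_indicator_open)
  next
    case empty
    then show ?case using L1_approx_const[of 0] by simp
  next
    case (compl A)
    have "(\<lambda>\<zeta>. indicator (UNIV - A) \<zeta>) = (\<lambda>\<zeta>. 1 + (- 1) * indicator A \<zeta> :: complex)"
      by (auto split: split_indicator)
    then show ?case
      using L1_approx_add[OF L1_approx_const[of 1] L1_approx_cmult[OF compl(2), of "- 1"]] by simp
  next
    case (union A)
    have meas: "A i \<in> sets borel" for i
      using union(2) by (auto simp: borel_def)
    define h where "h m \<zeta> = (\<Sum>i<m. indicator (A i) \<zeta> :: complex)" for m \<zeta>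
    have h_eq: "h m \<zeta> = indicator (\<Union>i<m. A i) \<zeta>" for m \<zeta>
      unfolding h_def using union(1)
      by (intro indicator_UN_disjoint[symmetric]) (auto intro: disjoint_family_on_mono)
    show ?case
    proof (rule L1_approx_dominated[where h = h and w = "\<lambda>_. 1"])
      show "L1_approx (h m)" for m
      proof (induction m)
        case 0
        then show ?case using L1_approx_const[of 0] by (simp add: h_def[abs_def])
      next
        case (Suc m)
        then show ?case using L1_approx_add[OF Suc union(3)[of m]] by (simp add: h_def[abs_def])
      qed
      show "(\<lambda>m. h m \<zeta>) \<longlonglongrightarrow> indicator (\<Union>i. A i) \<zeta>" for \<zeta>
        unfolding h_eq by (rule LIMSEQ_indicator_UN)
      show "cmod (h m \<zeta>) \<le> 1" for m \<zeta>
        unfolding h_eq by (auto split: split_indicator)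
      show "(\<integral>\<^sup>+\<zeta>. indicator (ball \<xi> r) \<zeta> * ennreal 1 \<partial>M) < top" for \<xi> r
        by (rule nn_integral_ball_const_less_top)
      have "(\<Union>i. A i) \<in> sets M" using meas by (auto simp: sets_M)
      then show "(\<lambda>\<zeta>. indicator (\<Union>i. A i) \<zeta> :: complex) \<in> borel_measurable M"
        by (rule borel_measurable_indicator)
    qed auto
  qed
qed

text \<open>Simple functions are reached by linearity; the limit case of
  \<open>integrable_induct\<close> comes with pointwise convergence and the majorant
  \<open>2 * |f|\<close>.\<close>

lemma L1_approx_integrable:
  fixes f :: "'a \<Rightarrow> complex"
  assumes "integrable M f"
  shows "L1_approx f"
  using assms
proof (induction rule: integrable_induct)
  case (base A c)
  then have "L1_approx (\<lambda>\<zeta>. c * indicator A \<zeta>)"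
    by (intro L1_approx_cmult L1_approx_indicator) (simp add: sets_M)
  moreover have "(\<lambda>\<zeta>. c * indicator A \<zeta>) = (\<lambda>\<zeta>. indicator A \<zeta> *\<^sub>R c)"
    by (auto split: split_indicator)
  ultimately show ?case by simp
next
  case (add f g)
  then show ?case by (intro L1_approx_add)
next
  case (lim f s)
  note lim.hyps(4)[measurable]
  show ?case
  proof (rule L1_approx_dominated[where h = s and w = "\<lambda>\<zeta>. 2 * cmod (f \<zeta>)"])
    show "(\<integral>\<^sup>+\<zeta>. indicator (ball \<xi> r) \<zeta> * ennreal (2 * cmod (f \<zeta>)) \<partial>M) < top" for \<xi> r
    proof -
      have "(\<integral>\<^sup>+\<zeta>. indicator (ball \<xi> r) \<zeta> * ennreal (2 * cmod (f \<zeta>)) \<partial>M)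
          \<le> (\<integral>\<^sup>+\<zeta>. ennreal (norm (2 * f \<zeta>)) \<partial>M)"
        by (intro nn_integral_mono) (auto simp: norm_mult split: split_indicator)
      also have "\<dots> < \<infinity>"
        using lim.hyps(4) by (intro integrable_iff_bounded[THEN iffD1, THEN conjunct2]) auto
      finally show ?thesis by simp
    qed
  qed (use lim in \<open>auto simp: space_M\<close>)
qed

text \<open>On the given ball \<open>f\<close> agrees with its truncation, which is integrable, so
  the distance to be made small is 0.\<close>

lemma L1_approx_loc_integrable:
  assumes f: "loc_integrable M f"
  shows "L1_approx f"
proof (rule L1_approx_limit[OF f])
  fix \<xi> :: 'a and r e :: real assume r: "0 < r" and e: "0 < e"
  define h where "h \<zeta> = indicator (ball \<xi> r) \<zeta> *\<^sub>R f \<zeta>" for \<zeta>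
  have "L1_approx h"
    using loc_integrableD(2)[OF f r, of \<xi>] by (intro L1_approx_integrable) (simp add: h_def[abs_def] set_integrable_def)
  moreover have "indicator (ball \<xi> r) \<zeta> * ennreal (cmod (f \<zeta> - h \<zeta>)) = 0" for \<zeta>
    by (auto simp: h_def split: split_indicator)
  then have "(\<integral>\<^sup>+\<zeta>. indicator (ball \<xi> r) \<zeta> * ennreal (cmod (f \<zeta> - h \<zeta>)) \<partial>M) < ennreal e"
    using e by (simp only:) simp
  ultimately show "\<exists>h. L1_approx h \<and>
      (\<integral>\<^sup>+\<zeta>. indicator (ball \<xi> r) \<zeta> * ennreal (cmod (f \<zeta> - h \<zeta>)) \<partial>M) < ennreal e" by blast
qed

lemma Tn_Pavg_L1_tendsto:
  assumes "loc_integrable M f" "0 < r"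
  shows "(\<lambda>n::nat. \<integral>\<^sup>+\<zeta>. indicator (ball \<xi> r) \<zeta> * ennreal (cmod (Tn S \<psi> (int n) (Pavg M f) \<zeta> - f \<zeta>)) \<partial>M)
    \<longlonglongrightarrow> 0"
proof -
  have "L1_error f \<xi> r \<longlonglongrightarrow> 0"
    using L1_approx_loc_integrable[OF assms(1)] assms(2) by (simp add: L1_approx_def)
  then show ?thesis by (simp only: L1_error_def[abs_def])
qed

text \<open>The hypothesis provides some almost-everywhere limit. By Fatou, the integral of its
  distance from \<open>f\<close> over a unit ball is at most the limit of the local errors, which is
  0.\<close>

lemma AE_Tn_Pavg_tendsto:
  assumes f: "loc_integrable M f" and s: "0 < s" "0 < p" "0 < q" "I_mem S M s p q (dnorm S (Pavg M f))"
  shows "AE \<zeta> in M. (\<lambda>n::nat. Tn S \<psi> (int n) (Pavg M f) \<zeta>) \<longlonglongrightarrow> f \<zeta>"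
proof -
  have [measurable]: "f \<in> borel_measurable M" using f by (rule loc_integrableD)
  let ?T = "\<lambda>n \<zeta>. Tn S \<psi> (int n) (Pavg M f) \<zeta>"
  let ?g = "Tr S \<psi> (Pavg M f)"
  have conv: "AE \<zeta> in M. (\<lambda>n. ?T n \<zeta>) \<longlonglongrightarrow> ?g \<zeta>"
    by (rule AE_Tn_tendsto_Tr[OF s])
  have "AE \<zeta> in M. ?g \<zeta> = f \<zeta>"
  proof (rule AE_by_balls)
    fix \<xi> :: 'a
    let ?B = "ball \<xi> (rad 0)"
    have "(\<integral>\<^sup>+\<zeta>. indicator ?B \<zeta> * ennreal (cmod (?g \<zeta> - f \<zeta>)) \<partial>M)
       = (\<integral>\<^sup>+\<zeta>. liminf (\<lambda>n. indicator ?B \<zeta> * ennreal (cmod (?T n \<zeta> - f \<zeta>))) \<partial>M)"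
    proof (rule nn_integral_cong_AE)
      show "AE \<zeta> in M. indicator ?B \<zeta> * ennreal (cmod (?g \<zeta> - f \<zeta>))
          = liminf (\<lambda>n. indicator ?B \<zeta> * ennreal (cmod (?T n \<zeta> - f \<zeta>)))"
        using conv
      proof eventually_elim
        case (elim \<zeta>)
        have "(\<lambda>n. ennreal (cmod (?T n \<zeta> - f \<zeta>))) \<longlonglongrightarrow> ennreal (cmod (?g \<zeta> - f \<zeta>))"
          by (intro tendsto_intros elim)
        then have "(\<lambda>n. indicator ?B \<zeta> * ennreal (cmod (?T n \<zeta> - f \<zeta>)))
            \<longlonglongrightarrow> indicator ?B \<zeta> * ennreal (cmod (?g \<zeta> - f \<zeta>))"
          by (auto split: split_indicator)
        then show ?case by (intro lim_imp_Liminf[symmetric]) auto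
      qed
    qed
    also have "\<dots> \<le> liminf (\<lambda>n. \<integral>\<^sup>+\<zeta>. indicator ?B \<zeta> * ennreal (cmod (?T n \<zeta> - f \<zeta>)) \<partial>M)"
      by (rule nn_integral_liminf) measurable
    also have "\<dots> = 0"
      by (intro lim_imp_Liminf Tn_Pavg_L1_tendsto f) auto
    finally have "AE \<zeta> in M. indicator ?B \<zeta> * ennreal (cmod (?g \<zeta> - f \<zeta>)) = 0"
      by (subst nn_integral_0_iff_AE[symmetric]) auto
    then show "AE \<zeta> in M. \<zeta> \<in> ?B \<longrightarrow> ?g \<zeta> = f \<zeta>"
      by eventually_elim (auto split: split_indicator_asm)
  qed
  with conv show ?thesis by eventually_elim simp
qed

end

text \<open>Equations between traces appear as limits of \<open>Tn\<close>, because
  \<open>lim\<close> in \<open>Tr\<close> carries no information for a divergent sequence: an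
  equation for \<open>Tr\<close> alone would not assert convergence.\<close>

theorem theorem2p5:
  fixes M :: "'z::metric_space measure"
    and S :: "int \<Rightarrow> 'z set"
    and \<psi> :: "int \<times> 'z \<Rightarrow> 'z \<Rightarrow> real"
    and C Q C'' s :: real and p q :: ereal
  assumes space_M: "space M = UNIV"
    and sets_M: "sets M = sets borel"
    and balls_pos_fin: "\<And>\<xi> r. 0 < r \<Longrightarrow> 0 < emeasure M (ball \<xi> r) \<and> emeasure M (ball \<xi> r) < \<infinity>"
    and C_ge: "1 \<le> C" and Q_pos: "0 < Q"
    and doubling: "\<And>\<xi> r t. 0 < r \<Longrightarrow> 1 \<le> t \<Longrightarrow>
        measure M (ball \<xi> (t * r)) \<le> C * t powr Q * measure M (ball \<xi> r)"
    and S_max: "\<And>n. maximal_separated (2 powr (- real_of_int n - 1)) (S n)"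
    and psi_nonneg: "\<And>x \<zeta>. x \<in> filling S \<Longrightarrow> 0 \<le> \<psi> x \<zeta>"
    and psi_supp: "\<And>x \<zeta>. x \<in> filling S \<Longrightarrow> \<zeta> \<notin> Bx x \<Longrightarrow> \<psi> x \<zeta> = 0"
    and psi_lip: "\<And>x. x \<in> filling S \<Longrightarrow>
        lipschitz_on (C'' * 2 powr real_of_int (fst x)) UNIV (\<psi> x)"
    and psi_pu: "\<And>n \<zeta>. (\<Sum>\<xi>\<in>active S n \<zeta>. \<psi> (n, \<xi>) \<zeta>) = 1"
    and s_pos: "0 < s"
    and p_gt: "ereal (Q / (Q + s)) < p"
    and q_pos: "0 < q"
  shows
    "(\<forall>u. I_mem S M s p q (\<lambda>x. cmod (u x)) \<longrightarrow>
        (AE \<zeta> in M. (\<lambda>n::nat. Tn S \<psi> (int n) u \<zeta>) \<longlonglongrightarrow> 0))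
   \<and> (\<exists>C'::real. \<forall>u. I_mem S M s p q (dnorm S u) \<longrightarrow>
        I_mem S M s p q (\<lambda>x. cmod (u x - Pavg M (Tr S \<psi> u) x))
        \<and> I_qnorm S M s p q (\<lambda>x. cmod (u x - Pavg M (Tr S \<psi> u) x))
            \<le> ennreal C' * I_qnorm S M s p q (dnorm S u)
        \<and> (AE \<zeta> in M. (\<lambda>n::nat. Tn S \<psi> (int n) (Pavg M (Tr S \<psi> u)) \<zeta>) \<longlonglongrightarrow> Tr S \<psi> u \<zeta>))
   \<and> (\<forall>f. loc_integrable M f \<and> I_mem S M s p q (dnorm S (Pavg M f)) \<longrightarrow>
        (AE \<zeta> in M. (\<lambda>n::nat. Tn S \<psi> (int n) (Pavg M f) \<zeta>) \<longlonglongrightarrow> f \<zeta>)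
        \<and> (\<forall>\<xi> r. 0 < r \<longrightarrow>
             (\<lambda>n::nat. \<integral>\<^sup>+\<zeta>. indicator (ball \<xi> r) \<zeta> * ennreal (cmod (Tn S \<psi> (int n) (Pavg M f) \<zeta> - f \<zeta>)) \<partial>M)
               \<longlonglongrightarrow> 0))"
proof -
  interpret filling_partition M S C Q \<psi> C''
    by unfold_locales (fact assms)+
  have p_pos: "0 < p"
  proof -
    have "0 < ereal (Q / (Q + s))" using Q_pos s_pos by simp
    then show ?thesis using p_gt by order
  qed
  obtain K where K: "0 \<le> K" and est: "\<And>u. I_mem S M s p q (dnorm S u) \<Longrightarrow>
      I_qnorm S M s p q (\<lambda>x. cmod (u x - Pavg M (Tr S \<psi> u) x)) \<le> ennreal K * I_qnorm S M s p q (dnorm S u)"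
    using Tr_estimate[OF s_pos p_gt q_pos] by blast
  have mem: "I_mem S M s p q (\<lambda>x. cmod (u x - Pavg M (Tr S \<psi> u) x))" if "I_mem S M s p q (dnorm S u)" for u
  proof -
    have "ennreal K * I_qnorm S M s p q (dnorm S u) < top"
      using that by (simp add: I_mem_def ennreal_mult_less_top)
    then show ?thesis using est[OF that] unfolding I_mem_def by (rule le_less_trans[rotated])
  qed
  show ?thesis
  proof (intro conjI allI impI exI[of _ K]; (elim conjE)?)
    fix u assume "I_mem S M s p q (\<lambda>x. cmod (u x))"
    then show "AE \<zeta> in M. (\<lambda>n::nat. Tn S \<psi> (int n) u \<zeta>) \<longlonglongrightarrow> 0"
      by (rule Tn_tendsto_0[OF s_pos p_pos q_pos])
  next
    fix u assume u: "I_mem S M s p q (dnorm S u)"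
    show "I_mem S M s p q (\<lambda>x. cmod (u x - Pavg M (Tr S \<psi> u) x))" by (rule mem[OF u])
    show "I_qnorm S M s p q (\<lambda>x. cmod (u x - Pavg M (Tr S \<psi> u) x)) \<le> ennreal K * I_qnorm S M s p q (dnorm S u)"
      by (rule est[OF u])
    show "AE \<zeta> in M. (\<lambda>n::nat. Tn S \<psi> (int n) (Pavg M (Tr S \<psi> u)) \<zeta>) \<longlonglongrightarrow> Tr S \<psi> u \<zeta>"
      by (rule Tn_Pavg_Tr_tendsto[OF s_pos p_pos q_pos u mem[OF u]])
  next
    fix f assume f: "loc_integrable M f" "I_mem S M s p q (dnorm S (Pavg M f))"
    show "AE \<zeta> in M. (\<lambda>n::nat. Tn S \<psi> (int n) (Pavg M f) \<zeta>) \<longlonglongrightarrow> f \<zeta>"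
      by (rule AE_Tn_Pavg_tendsto[OF f(1) s_pos p_pos q_pos f(2)])
    fix \<xi> :: 'z and r :: real assume "0 < r"
    then show "(\<lambda>n::nat. \<integral>\<^sup>+\<zeta>. indicator (ball \<xi> r) \<zeta> * ennreal (cmod (Tn S \<psi> (int n) (Pavg M f) \<zeta> - f \<zeta>)) \<partial>M)
        \<longlonglongrightarrow> 0"
      by (rule Tn_Pavg_L1_tendsto[OF f(1)])
  qed
qed

end
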